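(* Let $n\ge 1$ and let $\phi,\psi\in M_n(L^\infty)$. Assume that both $P(\overline z\,\phi(z))$ and $P(\overline z\,\phi^*(z))$ are regular. Then $T_\phi H_\psi^*=H_\psi T_\phi$ on $H^2_n$ if and only if there exists $A\in M_n(\mathbb{C})$ such that the following hold: (i) $\psi(z)-\phi(\overline z)A$ is analytic; (ii) $\widetilde\psi(z)+A\phi(z)$ is analytic; (iii) $\phi(\overline z)A\phi(z)$ is analytic.
   Context: $L^2,L^\infty$ are the square-integrable and essentially bounded functions on the unit circle $\mathbb{T}$ (normalized Lebesgue measure); $H^2\subset L^2$ is the closed subspace of functions whose negative Fourier coefficients vanish. $M_n(L^\infty)$ is the set of $n\times n$ matrices with entries in $L^\infty$, regarded as matrix-valued functions on $\mathbb{T}$. $H^2_n=\bigoplus_1^n H^2$ is the $\mathbb{C}^n$-valued Hardy space. $P$ denotes the orthogonal projection of $L^2$ onto $H^2$, applied entrywise to vector- and matrix-valued functions. For $F\in M_n(L^\infty)$, the Toeplitz operator $T_F:H^2_n\to H^2_n$ is $T_F(h)(z)=P(F(z)h(z))$ and the Hankel operator $H_F:H^2_n\to H^2_n$ is $H_F(h)(z)=P(\overline z F(\overline z)h(\overline z))$. $F^*$ is the pointwise adjoint of $F$, and $\widetilde F(z)=F^*(\overline z)$. A matrix-valued function on $\mathbb{T}$ is analytic if all its Fourier coefficients of negative index vanish. An $m\times m$ matrix-valued function with entries in $L^2$ is called regular if its $m$ column vectors are linearly independent in $L^2_m$, the space of $\mathbb{C}^m$-valued $L^2$ functions. *)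

theory Defs
  imports "HOL-Analysis.Analysis"
begin

text \<open>
  Elements of Lebesgue spaces on the unit circle are represented by functions \<open>complex \<Rightarrow> _\<close> of
  which only the values on the circle matter; equality in these spaces is equality almost
  everywhere with respect to \<open>circle_measure\<close>.
\<close>

definition circle_measure :: "complex measure" where
  "circle_measure =
     distr (uniform_measure lborel {0..2 * pi}) (restrict_space borel (sphere 0 1)) cis"

definition L2_circle :: "(complex \<Rightarrow> complex) set" where
  "L2_circle = {f. f \<in> borel_measurable circle_measure \<and>
                   integrable circle_measure (\<lambda>z. (cmod (f z))\<^sup>2)}"

definition Linf_circle :: "(complex \<Rightarrow> complex) set" where
  "Linf_circle = {f. f \<in> borel_measurable circle_measure \<and>
                     (\<exists>C. AE z in circle_measure. cmod (f z) \<le> C)}"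

definition fourier_coeff :: "(complex \<Rightarrow> complex) \<Rightarrow> int \<Rightarrow> complex" where
  "fourier_coeff f k = (LINT z|circle_measure. f z * z powi (- k))"

definition H2 :: "(complex \<Rightarrow> complex) set" where
  "H2 = {f \<in> L2_circle. \<forall>k<0. fourier_coeff f k = 0}"

definition L2_inner :: "(complex \<Rightarrow> complex) \<Rightarrow> (complex \<Rightarrow> complex) \<Rightarrow> complex" where
  "L2_inner f g = (LINT z|circle_measure. f z * cnj (g z))"

text \<open>
  The orthogonal projection of \<open>L2_circle\<close> onto \<open>H2\<close>. The two conditions determine \<open>g\<close> up to a
  null set, and the choice operator picks a representative.
\<close>
definition hardy_proj :: "(complex \<Rightarrow> complex) \<Rightarrow> complex \<Rightarrow> complex" where
  "hardy_proj f = (SOME g. g \<in> H2 \<and> (\<forall>h\<in>H2. L2_inner (\<lambda>z. f z - g z) h = 0))"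

definition hardy_proj_vec :: "(complex \<Rightarrow> complex^'n) \<Rightarrow> complex \<Rightarrow> complex^'n" where
  "hardy_proj_vec f = (\<lambda>z. \<chi> i. hardy_proj (\<lambda>w. f w $ i) z)"

definition hardy_proj_mat :: "(complex \<Rightarrow> complex^'n^'m) \<Rightarrow> complex \<Rightarrow> complex^'n^'m" where
  "hardy_proj_mat F = (\<lambda>z. \<chi> i j. hardy_proj (\<lambda>w. F w $ i $ j) z)"

definition H2_vec :: "(complex \<Rightarrow> complex^'n) set" where
  "H2_vec = {h. \<forall>i. (\<lambda>z. h z $ i) \<in> H2}"

definition L2_inner_vec :: "(complex \<Rightarrow> complex^'n) \<Rightarrow> (complex \<Rightarrow> complex^'n) \<Rightarrow> complex" where
  "L2_inner_vec f g = (\<Sum>i\<in>UNIV. L2_inner (\<lambda>z. f z $ i) (\<lambda>z. g z $ i))"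

definition Linf_mat :: "(complex \<Rightarrow> complex^'n^'m) set" where
  "Linf_mat = {F. \<forall>i j. (\<lambda>z. F z $ i $ j) \<in> Linf_circle}"

definition toeplitz ::
  "(complex \<Rightarrow> complex^'n^'n) \<Rightarrow> (complex \<Rightarrow> complex^'n) \<Rightarrow> complex \<Rightarrow> complex^'n" where
  "toeplitz F h = hardy_proj_vec (\<lambda>z. F z *v h z)"

definition hankel ::
  "(complex \<Rightarrow> complex^'n^'n) \<Rightarrow> (complex \<Rightarrow> complex^'n) \<Rightarrow> complex \<Rightarrow> complex^'n" where
  "hankel F h = hardy_proj_vec (\<lambda>z. cnj z *s (F (cnj z) *v h (cnj z)))"

text \<open>
  The Hilbert space adjoint of an operator \<open>S\<close> on \<open>H2_vec\<close>. For bounded linear \<open>S\<close> (such as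
  Toeplitz and Hankel operators with essentially bounded symbol) the function \<open>g\<close> below exists
  and is unique up to a null set.
\<close>
definition hardy_adjoint ::
  "((complex \<Rightarrow> complex^'n) \<Rightarrow> complex \<Rightarrow> complex^'n) \<Rightarrow>
    (complex \<Rightarrow> complex^'n) \<Rightarrow> complex \<Rightarrow> complex^'n" where
  "hardy_adjoint S h =
     (SOME g. g \<in> H2_vec \<and> (\<forall>k\<in>H2_vec. L2_inner_vec (S k) h = L2_inner_vec k g))"

definition cmat_adjoint :: "complex^'n^'m \<Rightarrow> complex^'m^'n" where
  "cmat_adjoint A = (\<chi> i j. cnj (A $ j $ i))"

definition tilde :: "(complex \<Rightarrow> complex^'n^'m) \<Rightarrow> complex \<Rightarrow> complex^'m^'n" where
  "tilde F = (\<lambda>z. cmat_adjoint (F (cnj z)))"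

definition analytic_mat :: "(complex \<Rightarrow> complex^'n^'m) \<Rightarrow> bool" where
  "analytic_mat F \<longleftrightarrow> (\<forall>k<0. \<forall>i j. fourier_coeff (\<lambda>z. F z $ i $ j) k = 0)"

text \<open>Linear independence over \<open>\<complex>\<close> of the family of columns, modulo null functions.\<close>
definition regular_mat :: "(complex \<Rightarrow> complex^'m^'m) \<Rightarrow> bool" where
  "regular_mat G \<longleftrightarrow>
     (\<forall>i j. (\<lambda>z. G z $ i $ j) \<in> L2_circle) \<and>
     (\<forall>c :: complex^'m.
        (AE z in circle_measure. (\<Sum>j\<in>UNIV. c $ j *s column j (G z)) = 0) \<longrightarrow> c = 0)"

end

theory Submission
  imports Defs
begin

text \<open>
  Write \<open>F\<^sub>k\<close> for the Fourier coefficients of \<open>F\<close>. The adjoint of \<open>H\<^sub>\<psi>\<close> is the Hankel operator of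
  \<open>tilde \<psi>\<close>. Applying the commutation relation to \<open>z\<^sup>j v\<close> and comparing neighbouring coefficients
  gives \<open>\<phi>\<^sub>i (tilde \<psi>)\<^sub>-\<^sub>j + \<psi>\<^sub>-\<^sub>i \<phi>\<^sub>-\<^sub>j = 0\<close> for \<open>i, j > 0\<close>. Regularity says that the \<open>\<phi>\<^sub>i\<close> have no
  common kernel and that the ranges of the \<open>\<phi>\<^sub>-\<^sub>j\<close> span, so the relation factors through a single
  matrix \<open>A\<close>, which is (i) and (ii). Conversely, given (i) and (ii), the commutator is minus the Hankel
  operator with symbol \<open>\<phi>(cnj z) A \<phi>(z)\<close>: with \<open>u = \<phi> h = u\<^sub>+ + u\<^sub>-\<close> and \<open>J f (z) = cnj z f(cnj z)\<close>, the
  term \<open>T\<^sub>\<phi> H\<^sub>\<psi>\<^sup>*\<close> contributes the part of this operator coming from \<open>u\<^sub>-\<close> and \<open>H\<^sub>\<psi> T\<^sub>\<phi>\<close> the part coming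
  from \<open>u\<^sub>+\<close>. So, under (i) and (ii), commutation is equivalent to (iii).
\<close>

section \<open>The circle measure\<close>

text \<open>All operators are handled through Fourier coefficients. \<open>hardy_proj\<close> and
  \<open>hardy_adjoint\<close> pick arbitrary representatives, so their values are known only almost
  everywhere: Riesz-Fischer supplies a candidate for the projection, and completeness of the powers
  of z shows that coefficients determine a function. Products of two series are never expanded;
  orthogonality replaces convolution. The factor \<open>cnj z\<close> in the regularity hypotheses
  shifts the constant term out of the range of P, so they concern exactly the coefficients of
  \<open>\<phi>\<close> at nonzero indices, which are the ones that the relation for i, j > 0
  involves. The matrix A arises because, for w in the range of
  \<open>\<phi>\<^sub>-\<^sub>j\<close>, the relation solves
  \<open>\<psi>\<^sub>-\<^sub>i w = \<phi>\<^sub>i y\<close> with one y for all i. As such w span,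
  the same can be solved for each basis vector, and the solutions are the columns of A. That gives
  (i); putting it back into the relation and using that the \<open>\<phi>\<^sub>i\<close> have no
  common kernel gives (ii).\<close>

lemma measurable_cis_circle [measurable]:
  "cis \<in> borel \<rightarrow>\<^sub>M restrict_space borel (sphere 0 1)"
  by (rule measurable_restrict_space2)
     (auto intro!: borel_measurable_continuous_onI continuous_intros)

lemma circle_measure_density:
  "circle_measure = distr (density lborel (\<lambda>t. ennreal (indicator {0..2 * pi} t / (2 * pi))))
     (restrict_space borel (sphere 0 1)) cis"
proof -
  have "(\<lambda>t::real. indicator {0..2 * pi} t / emeasure lborel {0..2 * pi}) =
      (\<lambda>t. ennreal (indicator {0..2 * pi} t / (2 * pi)))"
    by (auto simp: divide_ennreal[symmetric] ennreal_indicator fun_eq_iff)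
  then show ?thesis
    unfolding circle_measure_def uniform_measure_def by simp
qed

lemma sets_circle_measure [measurable_cong]:
  "sets circle_measure = sets (restrict_space borel (sphere 0 1))"
  by (simp add: circle_measure_def)

lemma space_circle_measure [simp]: "space circle_measure = sphere 0 1"
  by (simp add: circle_measure_def space_restrict_space)

lemma borel_measurable_circle_measureI:
  fixes f :: "complex \<Rightarrow> 'a::topological_space"
  shows "continuous_on (sphere 0 1) f \<Longrightarrow> f \<in> borel_measurable circle_measure"
  using borel_measurable_continuous_on_restrict measurable_cong_sets[OF sets_circle_measure refl]
  by blast

lemma nn_integral_circle_measure:
  fixes f :: "complex \<Rightarrow> ennreal"
  assumes "f \<in> borel_measurable circle_measure"
  shows "(\<integral>\<^sup>+z. f z \<partial>circle_measure) =
    (\<integral>\<^sup>+t. ennreal (indicator {0..2 * pi} t / (2 * pi)) * f (cis t) \<partial>lborel)"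
proof -
  have [measurable]: "f \<in> borel_measurable (restrict_space borel (sphere 0 1))"
    using assms measurable_cong_sets[OF sets_circle_measure refl] by blast
  show ?thesis
    unfolding circle_measure_density
    by (subst nn_integral_distr) (auto simp: nn_integral_density)
qed

lemma integral_circle_measure:
  fixes f :: "complex \<Rightarrow> complex"
  assumes "f \<in> borel_measurable circle_measure"
  shows "(LINT z|circle_measure. f z) =
    (LINT t|lborel. (indicator {0..2 * pi} t / (2 * pi)) *\<^sub>R f (cis t))"
proof -
  have [measurable]: "f \<in> borel_measurable (restrict_space borel (sphere 0 1))"
    using assms measurable_cong_sets[OF sets_circle_measure refl] by blast
  show ?thesis
    unfolding circle_measure_density
    by (subst integral_distr) (auto simp: integral_density)
qed

lemma emeasure_space_circle_measure: "emeasure circle_measure (space circle_measure) = 1"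
proof -
  have "emeasure circle_measure (space circle_measure) =
      emeasure (uniform_measure lborel {0..2 * pi}) {0..2 * pi}"
    unfolding circle_measure_def
    by (subst emeasure_distr)
      (use sets.top[of circle_measure] in
        \<open>auto simp: sets_circle_measure emeasure_uniform_measure_1 vimage_def\<close>)
  also have "\<dots> = 1"
    by (rule emeasure_uniform_measure_1) auto
  finally show ?thesis .
qed

interpretation circle: finite_measure circle_measure
  by standard (simp only: emeasure_space_circle_measure; simp)

lemma measure_space_circle_measure: "measure circle_measure (sphere 0 1) = 1"
  using emeasure_space_circle_measure by (simp add: measure_def)

lemma measurable_cnj_circle [measurable]: "cnj \<in> circle_measure \<rightarrow>\<^sub>M circle_measure"
proof -
  have "cnj \<in> restrict_space borel (sphere 0 1) \<rightarrow>\<^sub>M restrict_space borel (sphere 0 1)"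
    by (rule measurable_restrict_space3)
       (auto intro!: borel_measurable_continuous_onI continuous_intros)
  then show ?thesis
    using measurable_cong_sets[OF sets_circle_measure sets_circle_measure] by blast
qed

text \<open>On the parameter interval, conjugation is the reflection of t to 2 pi - t, which
  preserves Lebesgue measure. This invariance is why replacing z by \<open>cnj z\<close> reverses
  Fourier indices.\<close>

lemma distr_cnj_circle_measure: "distr circle_measure circle_measure cnj = circle_measure"
proof (rule measure_eqI)
  fix A assume "A \<in> sets (distr circle_measure circle_measure cnj)"
  then have A [measurable]: "A \<in> sets circle_measure" by simp
  have A' [measurable]: "A \<in> sets (restrict_space borel (sphere 0 1))"
    using A sets_circle_measure by simp
  have *: "cis (2 * pi - t) = cnj (cis t)" for t
    by (simp add: complex_eq_iff)
  have "emeasure circle_measure A = (\<integral>\<^sup>+z. indicator A z \<partial>circle_measure)"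
    by simp
  also have "\<dots> = (\<integral>\<^sup>+t. ennreal (indicator {0..2 * pi} t / (2 * pi)) * indicator A (cis t) \<partial>lborel)"
    by (rule nn_integral_circle_measure) auto
  also have "\<dots> = (\<integral>\<^sup>+t. ennreal (indicator {0..2 * pi} (2 * pi + -1 * t) / (2 * pi)) *
                        indicator A (cis (2 * pi + -1 * t)) \<partial>lborel)"
    by (subst nn_integral_real_affine[where c = "-1" and t = "2 * pi"]) auto
  also have "\<dots> = (\<integral>\<^sup>+t. ennreal (indicator {0..2 * pi} t / (2 * pi)) * indicator A (cnj (cis t)) \<partial>lborel)"
    by (intro nn_integral_cong) (auto simp: * indicator_def)
  also have "\<dots> = (\<integral>\<^sup>+z. indicator A (cnj z) \<partial>circle_measure)"
    by (rule nn_integral_circle_measure[symmetric]) measurable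
  also have "\<dots> = (\<integral>\<^sup>+z. indicator A z \<partial>distr circle_measure circle_measure cnj)"
    by (subst nn_integral_distr) auto
  finally show "emeasure (distr circle_measure circle_measure cnj) A = emeasure circle_measure A"
    by simp
qed simp

lemma integral_cnj_circle:
  fixes f :: "complex \<Rightarrow> complex"
  assumes [measurable]: "f \<in> borel_measurable circle_measure"
  shows "(LINT z|circle_measure. f (cnj z)) = (LINT z|circle_measure. f z)"
  using integral_distr[of cnj circle_measure circle_measure f]
  by (simp add: distr_cnj_circle_measure)

lemma integrable_cnj_circle:
  fixes f :: "complex \<Rightarrow> 'a::{banach, second_countable_topology}"
  assumes "integrable circle_measure f"
  shows "integrable circle_measure (\<lambda>z. f (cnj z))"
  by (rule integrable_distr[of cnj circle_measure circle_measure f])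
     (simp_all add: distr_cnj_circle_measure assms)

lemma AE_cnj_circle:
  assumes "AE z in circle_measure. P z"
  shows "AE z in circle_measure. P (cnj z)"
proof -
  have "AE z in distr circle_measure circle_measure cnj. P z"
    using assms by (simp only: distr_cnj_circle_measure)
  then show ?thesis
    by (rule AE_distrD[OF measurable_cnj_circle])
qed

lemma powi_circle_measurable [measurable]:
  "(\<lambda>z::complex. z powi k) \<in> borel_measurable circle_measure"
  by (rule borel_measurable_circle_measureI) (auto intro!: continuous_intros)

lemma integral_powi_circle:
  "(LINT z|circle_measure. z powi k) = (if k = 0 then 1 else 0)"
proof (cases "k = 0")
  case True
  then show ?thesis by (simp add: measure_space_circle_measure)
next
  case False
  \<comment> \<open>An antiderivative of the integrand in the angle t. Its end values agree because
    k is an integer.\<close>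
  define F where "F t = cis (real_of_int k * t) / (\<i> * of_int k) / complex_of_real (2 * pi)" for t
  have F: "(F has_vector_derivative cis (real_of_int k * t) / (2 * pi)) (at t within {0..2 * pi})" for t
  proof -
    have "((\<lambda>z. exp (\<i> * (of_int k * z)) / (\<i> * of_int k) / complex_of_real (2 * pi)) has_field_derivative
        exp (\<i> * (of_int k * of_real t)) / (2 * pi)) (at (of_real t))"
      using False by (auto intro!: derivative_eq_intros simp: field_simps)
    from has_vector_derivative_real_field[OF this] show ?thesis
      unfolding F_def cis_conv_exp
      by (auto intro: has_vector_derivative_at_within simp: o_def)
  qed
  have "(LINT z|circle_measure. z powi k) =
      (LINT t|lborel. indicator {0..2 * pi} t *\<^sub>R (cis (real_of_int k * t) / (2 * pi)))"
    by (subst integral_circle_measure)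
       (auto intro!: Bochner_Integration.integral_cong simp: cis_power_int indicator_def scaleR_conv_of_real)
  also have "\<dots> = F (2 * pi) - F 0"
    by (rule integral_FTC_Icc[OF _ F]) (auto intro!: continuous_intros)
  also have "\<dots> = 0"
    unfolding F_def using cis_multiple_2pi[of "real_of_int k"] by (simp add: mult.commute)
  finally show ?thesis using False by simp
qed

section \<open>Fourier coefficients and completeness of the trigonometric system\<close>

lemma integrable_mult_bounded_circle:
  fixes f g :: "complex \<Rightarrow> complex"
  assumes "integrable circle_measure f" and "g \<in> borel_measurable circle_measure"
    and "AE z in circle_measure. cmod (g z) \<le> C"
  shows "integrable circle_measure (\<lambda>z. f z * g z)"
proof (rule Bochner_Integration.integrable_bound)
  show "integrable circle_measure (\<lambda>z. C * cmod (f z))"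
    using assms(1) by auto
  show "(\<lambda>z. f z * g z) \<in> borel_measurable circle_measure"
    using assms by auto
  show "AE z in circle_measure. norm (f z * g z) \<le> norm (C * cmod (f z))"
    using assms(3)
  proof (eventually_elim)
    case (elim z)
    then have "cmod (f z) * cmod (g z) \<le> cmod (f z) * \<bar>C\<bar>"
      by (intro mult_left_mono) auto
    then show ?case by (simp add: norm_mult abs_mult mult.commute)
  qed
qed

lemma norm_powi_circle [simp]: "z \<in> sphere 0 1 \<Longrightarrow> cmod (z powi k) = 1"
  by (simp add: norm_power_int)

lemma integrable_mult_powi_circle:
  "integrable circle_measure f \<Longrightarrow> integrable circle_measure (\<lambda>z. f z * z powi k)"
  by (rule integrable_mult_bounded_circle[where C = 1]) (auto intro!: AE_I2)

section \<open>Calculation rules for Fourier coefficients\<close>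

lemma fourier_coeff_cong_AE:
  assumes "AE z in circle_measure. f z = g z"
    and "f \<in> borel_measurable circle_measure" "g \<in> borel_measurable circle_measure"
  shows "fourier_coeff f k = fourier_coeff g k"
  unfolding fourier_coeff_def using assms by (intro integral_cong_AE) auto

lemma fourier_coeff_cong:
  assumes "\<And>z. z \<in> sphere 0 1 \<Longrightarrow> f z = g z"
  shows "fourier_coeff f k = fourier_coeff g k"
  unfolding fourier_coeff_def using assms by (intro Bochner_Integration.integral_cong) auto

lemma fourier_coeff_add:
  assumes "integrable circle_measure f" "integrable circle_measure g"
  shows "fourier_coeff (\<lambda>z. f z + g z) k = fourier_coeff f k + fourier_coeff g k"
  unfolding fourier_coeff_def
  using assms by (simp add: ring_distribs integrable_mult_powi_circle)

lemma fourier_coeff_diff: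
  assumes "integrable circle_measure f" "integrable circle_measure g"
  shows "fourier_coeff (\<lambda>z. f z - g z) k = fourier_coeff f k - fourier_coeff g k"
  unfolding fourier_coeff_def
  using assms by (simp add: ring_distribs integrable_mult_powi_circle)

lemma fourier_coeff_sum:
  assumes "\<And>i. i \<in> I \<Longrightarrow> integrable circle_measure (f i)"
  shows "fourier_coeff (\<lambda>z. \<Sum>i\<in>I. f i z) k = (\<Sum>i\<in>I. fourier_coeff (f i) k)"
  unfolding fourier_coeff_def
  using assms by (simp add: sum_distrib_right integrable_mult_powi_circle)

lemma fourier_coeff_cmult: "fourier_coeff (\<lambda>z. c * f z) k = c * fourier_coeff f k"
  unfolding fourier_coeff_def by (simp add: mult.assoc)

lemma fourier_coeff_minus: "fourier_coeff (\<lambda>z. - f z) k = - fourier_coeff f k"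
  using fourier_coeff_cmult[of "-1"] by simp

lemma fourier_coeff_zero [simp]: "fourier_coeff (\<lambda>z. 0) k = 0"
  by (simp add: fourier_coeff_def)

lemma fourier_coeff_powi_mult:
  "fourier_coeff (\<lambda>z. z powi j * f z) k = fourier_coeff f (k - j)"
  unfolding fourier_coeff_def
proof (intro Bochner_Integration.integral_cong refl)
  fix z assume "z \<in> space circle_measure"
  then have "z \<noteq> 0" by auto
  then have "z powi (- (k - j)) = z powi j * z powi - k"
    by (simp flip: power_int_add)
  then show "z powi j * f z * z powi - k = f z * z powi - (k - j)"
    by simp
qed

lemma fourier_coeff_powi: "fourier_coeff (\<lambda>z. z powi j) k = (if k = j then 1 else 0)"
  using fourier_coeff_powi_mult[of j "\<lambda>_. 1" k] integral_powi_circle[of "j - k"]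
  by (simp add: fourier_coeff_def)

lemma fourier_coeff_const: "fourier_coeff (\<lambda>z. c) k = (if k = 0 then c else 0)"
  using fourier_coeff_cmult[of c "\<lambda>z. z powi 0"] fourier_coeff_powi[of 0] by simp

lemma cnj_circle: "z \<in> sphere 0 1 \<Longrightarrow> cnj z = inverse z"
  by (simp add: inverse_complex_def complex_eq_iff cmod_def)

lemma cnj_powi_circle: "z \<in> sphere 0 1 \<Longrightarrow> cnj z powi k = z powi (- k)"
  by (metis cnj_circle power_int_inverse power_int_minus)

lemma fourier_coeff_cnj: "fourier_coeff (\<lambda>z. cnj (f z)) k = cnj (fourier_coeff f (- k))"
proof -
  have "cnj (f z) * z powi (- k) = cnj (f z * z powi k)" if "z \<in> space circle_measure" for z
    using that by (simp add: cnj_powi_circle)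
  then have "fourier_coeff (\<lambda>z. cnj (f z)) k = (LINT z|circle_measure. cnj (f z * z powi k))"
    unfolding fourier_coeff_def by (intro Bochner_Integration.integral_cong) auto
  also have "\<dots> = cnj (fourier_coeff f (- k))"
    unfolding fourier_coeff_def minus_minus by (rule Bochner_Integration.integral_cnj)
  finally show ?thesis .
qed

lemma fourier_coeff_comp_cnj:
  assumes "f \<in> borel_measurable circle_measure"
  shows "fourier_coeff (\<lambda>z. f (cnj z)) k = fourier_coeff f (- k)"
proof -
  have "fourier_coeff f (- k) = (LINT z|circle_measure. f (cnj z) * cnj z powi k)"
    unfolding fourier_coeff_def using assms by (subst integral_cnj_circle) auto
  also have "\<dots> = fourier_coeff (\<lambda>z. f (cnj z)) k"
    unfolding fourier_coeff_def
    by (intro Bochner_Integration.integral_cong) (auto simp: cnj_powi_circle)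
  finally show ?thesis by simp
qed

section \<open>Completeness: an integrable function with vanishing coefficients is null\<close>

lemma real_polynomial_preserves_null_coeffs:
  assumes "real_polynomial_function p"
    and "integrable circle_measure f" and "\<And>k. fourier_coeff f k = 0"
  shows "integrable circle_measure (\<lambda>z. f z * of_real (p z)) \<and>
         (\<forall>k. fourier_coeff (\<lambda>z. f z * of_real (p z)) k = 0)"
  using assms
proof (induction arbitrary: f rule: real_polynomial_function.induct)
  case (linear l)
  interpret bounded_linear l by fact
  \<comment> \<open>From Re z = (z + 1/z)/2 and Im z = (z - 1/z)/(2i) on the circle: a real-linear
    function is a z + b/z there, so multiplying by it only mixes shifted coefficients.\<close>
  define a b where "a = (l 1 - \<i> * l \<i>) / 2" and "b = (l 1 + \<i> * l \<i>) / 2"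
  have l: "of_real (l z) = a * z powi 1 + b * z powi (-1)" if "z \<in> sphere 0 1" for z
  proof -
    have "l z = l (Re z *\<^sub>R 1 + Im z *\<^sub>R \<i>)"
      by (metis complex_eq mult.commute mult.right_neutral scaleR_conv_of_real)
    then have "l z = Re z * l 1 + Im z * l \<i>"
      by (simp add: add scaleR)
    moreover have "z powi (-1) = cnj z"
      using that by (simp add: cnj_circle power_int_minus)
    then have "a * z powi 1 + b * z powi (-1) = a * z + b * cnj z"
      by simp
    ultimately show ?thesis
      by (simp only:) (simp add: a_def b_def complex_eq_iff field_simps)
  qed
  have eq: "f z * of_real (l z) = a * (z powi 1 * f z) + b * (z powi (-1) * f z)"
    if "z \<in> sphere 0 1" for z
    using l[OF that] by (simp only:) (simp add: algebra_simps)
  have int: "integrable circle_measure (\<lambda>z. c * (z powi j * f z))" for c j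
    using integrable_mult_powi_circle[OF linear.prems(1), of j] by (simp add: mult.commute)
  show ?case
  proof (intro conjI allI)
    show "integrable circle_measure (\<lambda>z. f z * of_real (l z))"
      using Bochner_Integration.integrable_add[OF int[of a 1] int[of b "-1"]]
      by (rule Bochner_Integration.integrable_cong[THEN iffD1, rotated -1]) (auto simp: eq)
    fix k
    have "fourier_coeff (\<lambda>z. f z * of_real (l z)) k =
        fourier_coeff (\<lambda>z. a * (z powi 1 * f z) + b * (z powi (-1) * f z)) k"
      by (intro fourier_coeff_cong eq)
    then show "fourier_coeff (\<lambda>z. f z * of_real (l z)) k = 0"
      using int by (simp only: fourier_coeff_add fourier_coeff_cmult fourier_coeff_powi_mult linear.prems)
         simp
  qed
next
  case (const c)
  then show ?case
    using fourier_coeff_cmult[of "of_real c" f] by (simp add: mult.commute)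
next
  case (add p q)
  then show ?case by (simp add: ring_distribs fourier_coeff_add)
next
  \<comment> \<open>The hypothesis for q is applied to the function f p, which is why f is kept
    arbitrary in the induction.\<close>
  case (mult p q)
  then show ?case by (simp add: mult.assoc[symmetric])
qed

text \<open>By Stone-Weierstrass g is uniformly within e of a polynomial p. The integral of f p is
  its coefficient at 0, hence zero, and the error is at most e times the L1 norm of f.\<close>

lemma null_coeffs_integral_continuous:
  fixes g :: "complex \<Rightarrow> real"
  assumes f: "integrable circle_measure f" "\<And>k. fourier_coeff f k = 0"
    and g: "continuous_on (sphere 0 1) g"
  shows "(LINT z|circle_measure. f z * of_real (g z)) = 0"
proof -
  have "cmod (LINT z|circle_measure. f z * of_real (g z))
      \<le> e * (LINT z|circle_measure. cmod (f z))" if "e > 0" for e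
  proof -
    obtain p where p: "real_polynomial_function p"
      and close: "\<And>z. z \<in> sphere 0 1 \<Longrightarrow> \<bar>g z - p z\<bar> < e"
      using Stone_Weierstrass_real_polynomial_function[OF compact_sphere g \<open>e > 0\<close>] by blast
    note fp = real_polynomial_preserves_null_coeffs[OF p f]
    have "continuous_on (sphere 0 1) p"
      using p by (simp add: continuous_on_polymonial_function real_polynomial_function_eq)
    then have cont: "continuous_on (sphere 0 1) (\<lambda>z. complex_of_real (g z - p z))"
      using g by (intro continuous_intros)
    have int: "integrable circle_measure (\<lambda>z. f z * of_real (g z - p z))"
      by (rule integrable_mult_bounded_circle[OF f(1) borel_measurable_circle_measureI[OF cont], of e])
         (use close in \<open>auto intro!: AE_I2 less_imp_le simp: norm_of_real simp del: of_real_diff\<close>)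
    have "(LINT z|circle_measure. f z * of_real (g z)) =
        (LINT z|circle_measure. f z * of_real (g z - p z) + f z * of_real (p z))"
      by (simp add: algebra_simps)
    also have "\<dots> = (LINT z|circle_measure. f z * of_real (g z - p z)) + fourier_coeff (\<lambda>z. f z * of_real (p z)) 0"
      using int fp by (subst Bochner_Integration.integral_add) (auto simp: fourier_coeff_def)
    also have "\<dots> = (LINT z|circle_measure. f z * of_real (g z - p z))"
      using fp by simp
    also have "cmod \<dots> \<le> (LINT z|circle_measure. cmod (f z * of_real (g z - p z)))"
      by simp
    also have "\<dots> \<le> (LINT z|circle_measure. e * cmod (f z))"
    proof (rule integral_mono)
      fix z assume "z \<in> space circle_measure"
      then have "\<bar>g z - p z\<bar> * cmod (f z) \<le> e * cmod (f z)"
        using close[of z] by (intro mult_right_mono) auto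
      then show "cmod (f z * of_real (g z - p z)) \<le> e * cmod (f z)"
        by (simp add: norm_mult norm_of_real mult.commute del: of_real_diff)
    qed (use int f in auto)
    finally show ?thesis by simp
  qed
  \<comment> \<open>The bound holds for every e > 0, so e may tend to 0 from the right.\<close>
  then have "\<forall>\<^sub>F e in at_right 0. cmod (LINT z|circle_measure. f z * of_real (g z))
      \<le> e * (LINT z|circle_measure. cmod (f z))"
    by (auto intro: eventually_at_right_less[THEN eventually_mono])
  moreover have "((\<lambda>e. e * (LINT z|circle_measure. cmod (f z))) \<longlongrightarrow>
      0 * (LINT z|circle_measure. cmod (f z))) (at_right 0)"
    by (intro tendsto_intros)
  ultimately have "cmod (LINT z|circle_measure. f z * of_real (g z)) \<le>
      0 * (LINT z|circle_measure. cmod (f z))"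
    by (intro tendsto_lowerbound) auto
  then show ?thesis by simp
qed

text \<open>The indicator of a closed set is a pointwise limit of continuous functions with values
  in [0, 1], so dominated convergence by |f| carries the continuous case over.\<close>

lemma null_coeffs_integral_closed:
  assumes f: "integrable circle_measure f" "\<And>k. fourier_coeff f k = 0"
    and C: "closed C"
  shows "(LINT z|circle_measure. indicator C z *\<^sub>R f z) = 0"
proof (cases "C = {}")
  case False
  \<comment> \<open>Tents of height 1 on C that vanish at distance 1/n from it. The empty set is
    treated apart because \<open>infdist\<close> to it is 0 by convention, which would make every
    tent constantly 1.\<close>
  define g where "g n z = max 0 (1 - real n * infdist z C)" for n z
  have cont: "continuous_on (sphere 0 1) (\<lambda>z. complex_of_real (g n z))" for n
    unfolding g_def by (intro continuous_intros)
  have "(\<lambda>n. LINT z|circle_measure. f z * of_real (g n z)) \<longlonglongrightarrow>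
        (LINT z|circle_measure. indicator C z *\<^sub>R f z)"
  proof (rule integral_dominated_convergence[where w = "\<lambda>z. cmod (f z)"])
    have [measurable]: "(\<lambda>z. complex_of_real (g n z)) \<in> borel_measurable circle_measure" for n
      by (rule borel_measurable_circle_measureI[OF cont])
    have [measurable]: "f \<in> borel_measurable circle_measure"
      using f by auto
    show "(\<lambda>z. f z * of_real (g n z)) \<in> borel_measurable circle_measure" for n
      by measurable
    have "C \<inter> sphere 0 1 \<in> sets circle_measure"
      using C by (auto simp: sets_circle_measure sets_restrict_space)
    then have "(\<lambda>z. indicator (C \<inter> sphere 0 1) z *\<^sub>R f z) \<in> borel_measurable circle_measure"
      by measurable
    then show "(\<lambda>z. indicator C z *\<^sub>R f z) \<in> borel_measurable circle_measure"
      by (rule measurable_cong[THEN iffD1, rotated]) (auto simp: indicator_def)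
    show "integrable circle_measure (\<lambda>z. cmod (f z))" using f by auto
    show "AE z in circle_measure. cmod (f z * of_real (g n z)) \<le> cmod (f z)" for n
    proof (rule AE_I2)
      fix z
      have "\<bar>g n z\<bar> \<le> 1" by (simp add: g_def infdist_nonneg)
      then show "cmod (f z * of_real (g n z)) \<le> cmod (f z)"
        by (simp add: norm_mult mult_left_le)
    qed
    show "AE z in circle_measure. (\<lambda>n. f z * of_real (g n z)) \<longlonglongrightarrow> indicator C z *\<^sub>R f z"
    proof (rule AE_I2)
      fix z
      show "(\<lambda>n. f z * of_real (g n z)) \<longlonglongrightarrow> indicator C z *\<^sub>R f z"
      proof (cases "z \<in> C")
        case True
        then show ?thesis by (simp add: g_def)
      next
        case z: False
        then have "infdist z C > 0"
          using C False by (metis in_closed_iff_infdist_zero infdist_nonneg less_eq_real_def)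
        then have "\<forall>\<^sub>F n in sequentially. 1 / infdist z C \<le> real n"
          by (intro filterlim_real_sequentially[THEN filterlim_at_top[THEN iffD1], rule_format])
        then have "\<forall>\<^sub>F n in sequentially. f z * of_real (g n z) = 0"
          by eventually_elim (use \<open>infdist z C > 0\<close> in \<open>auto simp: g_def field_simps\<close>)
        then show ?thesis using z by (simp add: tendsto_eventually)
      qed
    qed
  qed
  moreover have "continuous_on (sphere 0 1) (g n)" for n
    unfolding g_def by (intro continuous_intros)
  ultimately show ?thesis
    using null_coeffs_integral_continuous[OF f] by (simp add: LIMSEQ_const_iff)
qed simp

text \<open>Closed sets form an intersection-stable generator of the Borel sets, and the sets over
  which f integrates to 0 are closed under complements and countable disjoint unions. So f has
  integral 0 over every measurable set and is null.\<close>

lemma fourier_coeff_zero_imp_AE_zero: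
  assumes f: "integrable circle_measure f" "\<And>k. fourier_coeff f k = 0"
  shows "AE z in circle_measure. f z = 0"
proof (rule circle.density_zero[OF f(1)])
  have meas: "B \<inter> sphere 0 1 \<in> sets circle_measure" if "B \<in> sets borel" for B
    using that by (auto simp: sets_circle_measure sets_restrict_space)
  \<comment> \<open>The induction runs over Borel sets of the plane, while the measurable sets here
    are their traces on the circle; the integral does not see the difference.\<close>
  have ind: "set_lebesgue_integral circle_measure B f =
      set_lebesgue_integral circle_measure (B \<inter> sphere 0 1) f" for B
    unfolding set_lebesgue_integral_def
    by (intro Bochner_Integration.integral_cong) (auto simp: indicator_def)
  have setint: "set_integrable circle_measure (B \<inter> sphere 0 1) f" if "B \<in> sets borel" for B
    unfolding set_integrable_def using meas[OF that] f(1) by (rule integrable_mult_indicator)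
  have all: "set_lebesgue_integral circle_measure B f = 0" if "B \<in> sets borel" for B
  proof -
    have "Int_stable (Collect closed :: complex set set)"
      by (auto simp: Int_stable_def)
    moreover have "Collect closed \<subseteq> Pow (UNIV :: complex set)" by auto
    moreover have "B \<in> sigma_sets UNIV (Collect closed)"
      using that by (simp add: borel_eq_closed)
    ultimately show ?thesis
    proof (induction rule: sigma_sets_induct_disjoint)
      case (basic C)
      then show ?case
        using null_coeffs_integral_closed[OF f] by (simp add: set_lebesgue_integral_def)
    next
      case empty
      show ?case by (simp add: set_lebesgue_integral_def)
    next
      case (compl B)
      then have [measurable]: "B \<in> sets borel" by (simp add: borel_eq_closed)
      have "set_lebesgue_integral circle_measure (UNIV - B) f = 
          (LINT z|circle_measure. indicator (UNIV \<inter> sphere 0 1) z *\<^sub>R f z -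
            indicator (B \<inter> sphere 0 1) z *\<^sub>R f z)"
        unfolding set_lebesgue_integral_def
        by (intro Bochner_Integration.integral_cong) (auto simp: indicator_def)
      also have "\<dots> = (LINT z|circle_measure. indicator (UNIV \<inter> sphere 0 1) z *\<^sub>R f z) -
          (LINT z|circle_measure. indicator (B \<inter> sphere 0 1) z *\<^sub>R f z)"
        by (intro Bochner_Integration.integral_diff setint[unfolded set_integrable_def]) simp_all
      also have "\<dots> = set_lebesgue_integral circle_measure UNIV f - set_lebesgue_integral circle_measure B f"
        using ind[of B] ind[of UNIV] by (simp only: set_lebesgue_integral_def)
      also have "set_lebesgue_integral circle_measure UNIV f = 0"
        using null_coeffs_integral_closed[OF f closed_UNIV] by (simp add: set_lebesgue_integral_def)
      finally show ?case using compl by simp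
    next
      case (union A)
      then have A: "A i \<in> sets borel" for i by (auto simp: borel_eq_closed)
      have *: "(\<Union>i. A i) \<inter> sphere 0 1 = (\<Union>i. A i \<inter> sphere 0 1)" by auto
      have "set_lebesgue_integral circle_measure (\<Union>i. A i \<inter> sphere 0 1) f =
          (\<Sum>i. set_lebesgue_integral circle_measure (A i \<inter> sphere 0 1) f)"
      proof (rule lebesgue_integral_countable_add)
        show "A i \<inter> sphere 0 1 \<in> sets circle_measure" for i by (rule meas[OF A])
        show "A i \<inter> sphere 0 1 \<inter> (A j \<inter> sphere 0 1) = {}" if "i \<noteq> j" for i j
          using union(1) that by (auto simp: disjoint_family_on_def)
        show "set_integrable circle_measure (\<Union>i. A i \<inter> sphere 0 1) f"
          using setint[of "\<Union>i. A i"] A unfolding * by blast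
      qed
      also have "\<dots> = 0"
        using union(3) by (simp only: ind[symmetric] suminf_zero)
      finally show ?case
        by (simp only: ind[of "\<Union> (range A)"] *)
    qed
  qed
  fix A assume "A \<in> sets circle_measure"
  then obtain B where "B \<in> sets borel" "A = sphere 0 1 \<inter> B"
    by (auto simp: sets_circle_measure sets_restrict_space)
  then show "set_lebesgue_integral circle_measure A f = 0"
    using all[of B] ind[of B] by (simp add: Int_commute)
qed

section \<open>Square-integrable functions\<close>

lemma borel_measurable_cnj [measurable]: "cnj \<in> borel_measurable borel"
  by (auto intro!: borel_measurable_continuous_onI continuous_intros)

lemma L2_circle_measurable [measurable_dest]:
  "f \<in> L2_circle \<Longrightarrow> f \<in> borel_measurable circle_measure"
  by (simp add: L2_circle_def)

lemma L2_circle_square_integrable: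
  "f \<in> L2_circle \<Longrightarrow> integrable circle_measure (\<lambda>z. (cmod (f z))\<^sup>2)"
  by (simp add: L2_circle_def)

lemma L2_circle_bound:
  assumes "f \<in> borel_measurable circle_measure" "integrable circle_measure b"
    and "AE z in circle_measure. (cmod (f z))\<^sup>2 \<le> b z"
  shows "f \<in> L2_circle"
proof -
  have "integrable circle_measure (\<lambda>z. (cmod (f z))\<^sup>2)"
    by (rule Bochner_Integration.integrable_bound[OF assms(2)]) (use assms in auto)
  then show ?thesis using assms by (simp add: L2_circle_def)
qed

lemma L2_circle_integrable_mult:
  assumes "f \<in> L2_circle" "g \<in> L2_circle"
  shows "integrable circle_measure (\<lambda>z. f z * g z)"
proof (rule Bochner_Integration.integrable_bound)
  show "integrable circle_measure (\<lambda>z. (cmod (f z))\<^sup>2 + (cmod (g z))\<^sup>2)"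
    using assms by (auto simp: L2_circle_def)
  show "(\<lambda>z. f z * g z) \<in> borel_measurable circle_measure"
    using assms by measurable
  show "AE z in circle_measure. norm (f z * g z) \<le> norm ((cmod (f z))\<^sup>2 + (cmod (g z))\<^sup>2)"
  proof (rule AE_I2)
    fix z
    have "cmod (f z) * cmod (g z) \<le> (cmod (f z))\<^sup>2 + (cmod (g z))\<^sup>2"
      using sum_squares_bound[of "cmod (f z)" "cmod (g z)"]
        mult_nonneg_nonneg[OF norm_ge_zero[of "f z"] norm_ge_zero[of "g z"]]
      by linarith
    then show "norm (f z * g z) \<le> norm ((cmod (f z))\<^sup>2 + (cmod (g z))\<^sup>2)"
      by (simp add: norm_mult)
  qed
qed

section \<open>Essentially bounded functions and closure properties of both spaces\<close>

lemma Linf_circle_measurable [measurable_dest]: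
  "f \<in> Linf_circle \<Longrightarrow> f \<in> borel_measurable circle_measure"
  by (simp add: Linf_circle_def)

lemma Linf_circle_boundI:
  "f \<in> borel_measurable circle_measure \<Longrightarrow> AE z in circle_measure. cmod (f z) \<le> C \<Longrightarrow> f \<in> Linf_circle"
  by (auto simp: Linf_circle_def)

lemma Linf_circle_const: "(\<lambda>z. c) \<in> Linf_circle"
  by (rule Linf_circle_boundI[of _ "cmod c"]) auto

lemma Linf_circle_powi: "(\<lambda>z. z powi k) \<in> Linf_circle"
  by (rule Linf_circle_boundI[of _ 1]) (auto intro!: AE_I2)

lemma Linf_circle_add:
  assumes "f \<in> Linf_circle" "g \<in> Linf_circle"
  shows "(\<lambda>z. f z + g z) \<in> Linf_circle"
proof -
  obtain C D where "AE z in circle_measure. cmod (f z) \<le> C" "AE z in circle_measure. cmod (g z) \<le> D"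
    using assms by (auto simp: Linf_circle_def)
  then have "AE z in circle_measure. cmod (f z + g z) \<le> C + D"
    by eventually_elim (auto intro: order_trans[OF norm_triangle_ineq] add_mono)
  with assms show ?thesis by (auto intro!: Linf_circle_boundI)
qed

lemma Linf_circle_mult:
  assumes "f \<in> Linf_circle" "g \<in> Linf_circle"
  shows "(\<lambda>z. f z * g z) \<in> Linf_circle"
proof -
  obtain C D where "AE z in circle_measure. cmod (f z) \<le> C" "AE z in circle_measure. cmod (g z) \<le> D"
    using assms by (auto simp: Linf_circle_def)
  then have "AE z in circle_measure. cmod (f z * g z) \<le> \<bar>C\<bar> * \<bar>D\<bar>"
    by eventually_elim (auto simp: norm_mult intro!: mult_mono)
  with assms show ?thesis by (auto intro!: Linf_circle_boundI)
qed

lemma Linf_circle_minus: "f \<in> Linf_circle \<Longrightarrow> (\<lambda>z. - f z) \<in> Linf_circle"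
  using Linf_circle_mult[OF Linf_circle_const[of "-1"]] by simp

lemma Linf_circle_diff:
  "f \<in> Linf_circle \<Longrightarrow> g \<in> Linf_circle \<Longrightarrow> (\<lambda>z. f z - g z) \<in> Linf_circle"
  using Linf_circle_add[OF _ Linf_circle_minus, of f g] by simp

lemma Linf_circle_sum:
  "(\<And>i. i \<in> I \<Longrightarrow> f i \<in> Linf_circle) \<Longrightarrow> (\<lambda>z. \<Sum>i\<in>I. f i z) \<in> Linf_circle"
  by (induction I rule: infinite_finite_induct) (auto intro: Linf_circle_const Linf_circle_add)

lemma Linf_circle_cnj: "f \<in> Linf_circle \<Longrightarrow> (\<lambda>z. cnj (f z)) \<in> Linf_circle"
  unfolding Linf_circle_def by auto

lemma Linf_circle_comp_cnj: "f \<in> Linf_circle \<Longrightarrow> (\<lambda>z. f (cnj z)) \<in> Linf_circle"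
  unfolding Linf_circle_def using AE_cnj_circle by (auto intro: measurable_compose[OF measurable_cnj_circle])

lemma L2_circle_mult:
  assumes "f \<in> Linf_circle" "g \<in> L2_circle"
  shows "(\<lambda>z. f z * g z) \<in> L2_circle"
proof -
  obtain C where "AE z in circle_measure. cmod (f z) \<le> C"
    using assms by (auto simp: Linf_circle_def)
  then have "AE z in circle_measure. (cmod (f z * g z))\<^sup>2 \<le> C\<^sup>2 * (cmod (g z))\<^sup>2"
    by eventually_elim (auto simp: norm_mult power_mult_distrib intro!: mult_right_mono power_mono)
  moreover have "integrable circle_measure (\<lambda>z. C\<^sup>2 * (cmod (g z))\<^sup>2)"
    using assms L2_circle_square_integrable by auto
  ultimately show ?thesis
    using assms by (intro L2_circle_bound) auto
qed

lemma L2_circle_const: "(\<lambda>z. c) \<in> L2_circle"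
  by (rule L2_circle_bound[of _ "\<lambda>_. (cmod c)\<^sup>2"]) auto

lemma Linf_circle_imp_L2: "f \<in> Linf_circle \<Longrightarrow> f \<in> L2_circle"
  using L2_circle_mult[OF _ L2_circle_const[of 1]] by simp

lemma L2_circle_power: "(\<lambda>z. z ^ n) \<in> L2_circle"
  using Linf_circle_imp_L2[OF Linf_circle_powi[of "int n"]] by simp

lemma L2_circle_integrable: "f \<in> L2_circle \<Longrightarrow> integrable circle_measure f"
  using L2_circle_integrable_mult[OF _ L2_circle_const[of 1]] by simp

lemma L2_circle_add:
  assumes "f \<in> L2_circle" "g \<in> L2_circle"
  shows "(\<lambda>z. f z + g z) \<in> L2_circle"
proof (rule L2_circle_bound)
  show "integrable circle_measure (\<lambda>z. 2 * (cmod (f z))\<^sup>2 + 2 * (cmod (g z))\<^sup>2)"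
    using assms by (auto simp: L2_circle_def)
  show "AE z in circle_measure. (cmod (f z + g z))\<^sup>2 \<le> 2 * (cmod (f z))\<^sup>2 + 2 * (cmod (g z))\<^sup>2"
  proof (rule AE_I2)
    fix z
    have "(cmod (f z + g z))\<^sup>2 \<le> (cmod (f z) + cmod (g z))\<^sup>2"
      by (intro power_mono norm_triangle_ineq) auto
    also have "\<dots> \<le> 2 * (cmod (f z))\<^sup>2 + 2 * (cmod (g z))\<^sup>2"
      using sum_squares_bound[of "cmod (f z)" "cmod (g z)"] by (simp add: power2_sum)
    finally show "(cmod (f z + g z))\<^sup>2 \<le> 2 * (cmod (f z))\<^sup>2 + 2 * (cmod (g z))\<^sup>2" .
  qed
qed (use assms in measurable)

lemma L2_circle_cmult: "f \<in> L2_circle \<Longrightarrow> (\<lambda>z. c * f z) \<in> L2_circle"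
  by (rule L2_circle_mult[OF Linf_circle_const])

lemma L2_circle_minus: "f \<in> L2_circle \<Longrightarrow> (\<lambda>z. - f z) \<in> L2_circle"
  using L2_circle_cmult[of f "-1"] by simp

lemma L2_circle_diff:
  "f \<in> L2_circle \<Longrightarrow> g \<in> L2_circle \<Longrightarrow> (\<lambda>z. f z - g z) \<in> L2_circle"
  using L2_circle_add[OF _ L2_circle_minus, of f g] by simp

lemma L2_circle_sum:
  "(\<And>i. i \<in> I \<Longrightarrow> f i \<in> L2_circle) \<Longrightarrow> (\<lambda>z. \<Sum>i\<in>I. f i z) \<in> L2_circle"
  by (induction I rule: infinite_finite_induct) (auto intro: L2_circle_const L2_circle_add)

lemma L2_circle_cnj: "f \<in> L2_circle \<Longrightarrow> (\<lambda>z. cnj (f z)) \<in> L2_circle"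
  unfolding L2_circle_def by auto

lemma L2_circle_comp_cnj: "f \<in> L2_circle \<Longrightarrow> (\<lambda>z. f (cnj z)) \<in> L2_circle"
  unfolding L2_circle_def
  using integrable_cnj_circle[of "\<lambda>z. (cmod (f z))\<^sup>2"]
  by (auto intro: measurable_compose[OF measurable_cnj_circle])

section \<open>The inner product and trigonometric polynomials\<close>

lemma L2_inner_integrable:
  "f \<in> L2_circle \<Longrightarrow> g \<in> L2_circle \<Longrightarrow> integrable circle_measure (\<lambda>z. f z * cnj (g z))"
  by (intro L2_circle_integrable_mult L2_circle_cnj)

lemma L2_inner_diff_left:
  "f \<in> L2_circle \<Longrightarrow> g \<in> L2_circle \<Longrightarrow> h \<in> L2_circle \<Longrightarrow>
    L2_inner (\<lambda>z. f z - g z) h = L2_inner f h - L2_inner g h"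
  unfolding L2_inner_def by (simp add: left_diff_distrib L2_inner_integrable)

lemma L2_inner_commute: "L2_inner g f = cnj (L2_inner f g)"
proof -
  have "L2_inner g f = (LINT z|circle_measure. cnj (f z * cnj (g z)))"
    unfolding L2_inner_def by (simp add: mult.commute)
  also have "\<dots> = cnj (L2_inner f g)"
    unfolding L2_inner_def by (rule Bochner_Integration.integral_cnj)
  finally show ?thesis .
qed

lemma L2_inner_diff_right:
  "f \<in> L2_circle \<Longrightarrow> g \<in> L2_circle \<Longrightarrow> h \<in> L2_circle \<Longrightarrow>
    L2_inner h (\<lambda>z. f z - g z) = L2_inner h f - L2_inner h g"
  by (simp add: L2_inner_commute[of h] L2_inner_diff_left)

lemma cnj_mult_self: "cnj z * z = of_real ((cmod z)\<^sup>2)"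
  unfolding complex_norm_square by (rule mult.commute)

lemma L2_inner_self: "L2_inner f f = of_real (LINT z|circle_measure. (cmod (f z))\<^sup>2)"
proof -
  have "f z * cnj (f z) = of_real ((cmod (f z))\<^sup>2)" for z
    by (rule complex_norm_square[symmetric])
  then show ?thesis
    unfolding L2_inner_def by (simp only: integral_complex_of_real)
qed

lemma L2_inner_cong_AE:
  assumes "AE z in circle_measure. f z = g z" "AE z in circle_measure. h z = k z"
    and "f \<in> borel_measurable circle_measure" "g \<in> borel_measurable circle_measure"
    and "h \<in> borel_measurable circle_measure" "k \<in> borel_measurable circle_measure"
  shows "L2_inner f h = L2_inner g k"
  unfolding L2_inner_def using assms by (intro integral_cong_AE) auto

lemma fourier_coeff_eq_L2_inner: "fourier_coeff f k = L2_inner f (\<lambda>z. z powi k)"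
  unfolding fourier_coeff_def L2_inner_def
  by (intro Bochner_Integration.integral_cong) (auto simp: cnj_powi_circle)

lemma fourier_coeff_power: "fourier_coeff (\<lambda>z. z ^ n) k = (if k = int n then 1 else 0)"
  using fourier_coeff_powi[of "int n"] by simp

lemma L2_inner_trig_poly:
  assumes "f \<in> L2_circle"
  shows "L2_inner f (\<lambda>z. \<Sum>n\<in>K. c n * z ^ n) = (\<Sum>n\<in>K. cnj (c n) * fourier_coeff f (int n))"
proof -
  have "L2_inner f (\<lambda>z. \<Sum>n\<in>K. c n * z ^ n) =
      (LINT z|circle_measure. (\<Sum>n\<in>K. cnj (c n) * (f z * cnj (z ^ n))))"
    unfolding L2_inner_def by (simp add: sum_distrib_left mult.left_commute)
  also have "\<dots> = (\<Sum>n\<in>K. cnj (c n) * fourier_coeff f (int n))"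
    unfolding fourier_coeff_eq_L2_inner L2_inner_def
    using L2_inner_integrable[OF assms L2_circle_power]
    by (subst Bochner_Integration.integral_sum) simp_all
  finally show ?thesis .
qed

lemma fourier_coeff_trig_poly:
  assumes "finite K"
  shows "fourier_coeff (\<lambda>z. \<Sum>n\<in>K. c n * z ^ n) k =
    (if k \<ge> 0 \<and> nat k \<in> K then c (nat k) else 0)"
proof -
  have "fourier_coeff (\<lambda>z. \<Sum>n\<in>K. c n * z ^ n) k = (\<Sum>n\<in>K. c n * (if k = int n then 1 else 0))"
    by (subst fourier_coeff_sum)
       (auto intro!: L2_circle_integrable L2_circle_cmult L2_circle_power
         simp: fourier_coeff_cmult fourier_coeff_power)
  also have "\<dots> = (\<Sum>n\<in>K. if n = nat k then (if k \<ge> 0 then c (nat k) else 0) else 0)"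
    by (intro sum.cong) auto
  also have "\<dots> = (if k \<ge> 0 \<and> nat k \<in> K then c (nat k) else 0)"
    using assms by (subst sum.delta) auto
  finally show ?thesis .
qed

lemma L2_circle_trig_poly: "(\<lambda>z. \<Sum>n\<in>K. c n * z ^ n) \<in> L2_circle"
  by (intro L2_circle_sum L2_circle_cmult L2_circle_power)

lemma integral_norm_trig_poly:
  assumes "finite K"
  shows "(LINT z|circle_measure. (cmod (\<Sum>n\<in>K. c n * z ^ n))\<^sup>2) = (\<Sum>n\<in>K. (cmod (c n))\<^sup>2)"
proof -
  have "complex_of_real (LINT z|circle_measure. (cmod (\<Sum>n\<in>K. c n * z ^ n))\<^sup>2) =
      (\<Sum>n\<in>K. cnj (c n) * c n)"
    unfolding L2_inner_self[symmetric]
    using assms by (simp add: L2_inner_trig_poly L2_circle_trig_poly fourier_coeff_trig_poly)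
  also have "\<dots> = complex_of_real (\<Sum>n\<in>K. (cmod (c n))\<^sup>2)"
    by (simp only: cnj_mult_self of_real_sum)
  finally show ?thesis by (simp only: of_real_eq_iff)
qed

section \<open>The Hardy projection\<close>

text \<open>The partial sum S is the orthogonal projection of f onto the span of 1, ..., z^(N-1), so
  the squared norm of f - S is the difference of the two sides. The indices are nonnegative because
  the series to be summed is the analytic part of f.\<close>

lemma bessel_inequality:
  assumes f: "f \<in> L2_circle"
  shows "(\<Sum>n<N. (cmod (fourier_coeff f (int n)))\<^sup>2) \<le> (LINT z|circle_measure. (cmod (f z))\<^sup>2)"
proof -
  define S where "S z = (\<Sum>n<N. fourier_coeff f (int n) * z ^ n)" for z
  have S_eq: "(\<lambda>z. \<Sum>n<N. fourier_coeff f (int n) * z ^ n) = S"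
    unfolding S_def ..
  have S: "S \<in> L2_circle" unfolding S_def by (rule L2_circle_trig_poly)
  have fS: "(\<lambda>z. f z - S z) \<in> L2_circle" using f S by (rule L2_circle_diff)
  have coeff: "fourier_coeff (\<lambda>z. f z - S z) (int n) = 0" if "n < N" for n
    using that fourier_coeff_trig_poly[of "{..<N}" "\<lambda>n. fourier_coeff f (int n)" "int n"]
    by (simp add: fourier_coeff_diff L2_circle_integrable f S S_eq)
  have "L2_inner (\<lambda>z. f z - S z) S = 0"
    using L2_inner_trig_poly[OF fS, of "\<lambda>n. fourier_coeff f (int n)" "{..<N}"] coeff
    by (simp add: S_eq)
  moreover have "L2_inner f S = (\<Sum>n<N. (cmod (fourier_coeff f (int n)))\<^sup>2)"
    using L2_inner_trig_poly[OF f, of "\<lambda>n. fourier_coeff f (int n)" "{..<N}"]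
    by (simp only: S_eq cnj_mult_self of_real_sum)
  then have "L2_inner S f = (\<Sum>n<N. (cmod (fourier_coeff f (int n)))\<^sup>2)"
    by (subst L2_inner_commute) simp
  ultimately have "L2_inner (\<lambda>z. f z - S z) (\<lambda>z. f z - S z) =
      of_real (LINT z|circle_measure. (cmod (f z))\<^sup>2) - of_real (\<Sum>n<N. (cmod (fourier_coeff f (int n)))\<^sup>2)"
    by (simp only: L2_inner_diff_right[OF f S fS] L2_inner_diff_left[OF f S f] L2_inner_self[of f] diff_0_right)
  then have "(LINT z|circle_measure. (cmod (f z - S z))\<^sup>2) =
      (LINT z|circle_measure. (cmod (f z))\<^sup>2) - (\<Sum>n<N. (cmod (fourier_coeff f (int n)))\<^sup>2)"
    unfolding L2_inner_self by (simp only: of_real_diff[symmetric] of_real_eq_iff)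
  moreover have "0 \<le> (LINT z|circle_measure. (cmod (f z - S z))\<^sup>2)" by simp
  ultimately show ?thesis by simp
qed

text \<open>A weighted arithmetic-geometric mean bound, integrated, in the role of Cauchy-Schwarz.
  The free weight e allows the term in h to be made small first and the term in f
  afterwards.\<close>

lemma norm_L2_inner_le:
  assumes f: "f \<in> L2_circle" and h: "h \<in> L2_circle" and e: "e > 0"
  shows "cmod (L2_inner f h) \<le>
    e * (LINT z|circle_measure. (cmod (h z))\<^sup>2) + (LINT z|circle_measure. (cmod (f z))\<^sup>2) / e"
proof -
  have int: "integrable circle_measure (\<lambda>z. e * (cmod (h z))\<^sup>2)"
    "integrable circle_measure (\<lambda>z. (cmod (f z))\<^sup>2 / e)"
    using f h L2_circle_square_integrable by auto
  have "cmod (L2_inner f h) \<le> (LINT z|circle_measure. cmod (f z * cnj (h z)))"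
    unfolding L2_inner_def by simp
  also have "\<dots> \<le> (LINT z|circle_measure. e * (cmod (h z))\<^sup>2 + (cmod (f z))\<^sup>2 / e)"
  proof (rule integral_mono)
    show "integrable circle_measure (\<lambda>z. cmod (f z * cnj (h z)))"
      using L2_inner_integrable[OF f h] by (rule integrable_norm)
    show "integrable circle_measure (\<lambda>z. e * (cmod (h z))\<^sup>2 + (cmod (f z))\<^sup>2 / e)"
      using int by (rule Bochner_Integration.integrable_add)
    fix z
    have "2 * (e * cmod (h z)) * cmod (f z) \<le> (e * cmod (h z))\<^sup>2 + (cmod (f z))\<^sup>2"
      by (rule sum_squares_bound)
    moreover have "0 \<le> e * cmod (h z) * cmod (f z)" using e by simp
    ultimately have "(e * cmod (h z)) * cmod (f z) \<le> (e * cmod (h z))\<^sup>2 + (cmod (f z))\<^sup>2"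
      by linarith
    then have "e * (cmod (f z) * cmod (h z)) \<le> e * (e * (cmod (h z))\<^sup>2 + (cmod (f z))\<^sup>2 / e)"
      using e by (simp add: power2_eq_square algebra_simps)
    then show "cmod (f z * cnj (h z)) \<le> e * (cmod (h z))\<^sup>2 + (cmod (f z))\<^sup>2 / e"
      using e by (simp only: mult_le_cancel_left_pos norm_mult complex_mod_cnj)
  qed
  also have "\<dots> = e * (LINT z|circle_measure. (cmod (h z))\<^sup>2) + (LINT z|circle_measure. (cmod (f z))\<^sup>2) / e"
    using int by (subst Bochner_Integration.integral_add) auto
  finally show ?thesis .
qed

lemma tendsto_L2_inner:
  assumes u: "\<And>N. u N \<in> L2_circle" and g: "g \<in> L2_circle" and h: "h \<in> L2_circle"
    and lim: "(\<lambda>N::nat. LINT z|circle_measure. (cmod (u N z - g z))\<^sup>2) \<longlonglongrightarrow> 0"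
  shows "(\<lambda>N. L2_inner (u N) h) \<longlonglongrightarrow> L2_inner g h"
proof (rule LIMSEQ_I)
  fix r :: real assume r: "r > 0"
  define H where "H = (LINT z|circle_measure. (cmod (h z))\<^sup>2)"
  have H: "H \<ge> 0" by (simp add: H_def)
  \<comment> \<open>Makes e * H smaller than r/2; the summand 1 keeps the denominator positive when
    H = 0.\<close>
  define e where "e = r / (2 * (H + 1))"
  have e: "e > 0" using r H by (simp add: e_def)
  have eH: "e * H < r / 2" using r H by (simp add: e_def field_simps)
  have "e * (r / 2) > 0" using e r by simp
  from order_tendstoD(2)[OF lim this] obtain N0
    where N0: "\<And>N. N \<ge> N0 \<Longrightarrow> (LINT z|circle_measure. (cmod (u N z - g z))\<^sup>2) < e * (r / 2)"
    by (auto simp: eventually_sequentially)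
  show "\<exists>N0. \<forall>N\<ge>N0. norm (L2_inner (u N) h - L2_inner g h) < r"
  proof (intro exI allI impI)
    fix N assume "N \<ge> N0"
    have "norm (L2_inner (u N) h - L2_inner g h) = cmod (L2_inner (\<lambda>z. u N z - g z) h)"
      by (simp add: L2_inner_diff_left[OF u g h])
    also have "\<dots> \<le> e * H + (LINT z|circle_measure. (cmod (u N z - g z))\<^sup>2) / e"
      unfolding H_def by (rule norm_L2_inner_le[OF L2_circle_diff[OF u g] h e])
    also have "\<dots> < r / 2 + r / 2"
      using eH N0[OF \<open>N \<ge> N0\<close>] e by (intro add_strict_mono) (auto simp: divide_less_eq mult.commute)
    finally show "norm (L2_inner (u N) h - L2_inner g h) < r" by simp
  qed
qed

text \<open>Orthonormality of the powers makes the partial sums Cauchy in L2, hence in L1, so a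
  subsequence is Cauchy almost everywhere. Its pointwise limit is g, and Fatou's lemma turns the
  Cauchy estimate into L2 convergence of the whole sequence.\<close>

lemma riesz_fischer:
  assumes "summable (\<lambda>n. (cmod (c n))\<^sup>2)"
  obtains g where "g \<in> L2_circle"
    and "(\<lambda>N. LINT z|circle_measure. (cmod ((\<Sum>n<N. c n * z ^ n) - g z))\<^sup>2) \<longlonglongrightarrow> 0"
proof -
  define S where "S N z = (\<Sum>n<N. c n * z ^ n)" for N and z :: complex
  have S: "S N \<in> L2_circle" for N unfolding S_def by (rule L2_circle_trig_poly)
  note [measurable] = L2_circle_measurable[OF S]
  have cauchy: "\<exists>N. \<forall>i\<ge>N. \<forall>j\<ge>N. (LINT z|circle_measure. (cmod (S i z - S j z))\<^sup>2) < e"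
    if "e > 0" for e
  proof -
    obtain N where N: "\<And>m n. m \<ge> N \<Longrightarrow> norm (\<Sum>n\<in>{m..<n}. (cmod (c n))\<^sup>2) < e"
      using assms \<open>e > 0\<close> unfolding summable_Cauchy by blast
    have *: "(LINT z|circle_measure. (cmod (S i z - S j z))\<^sup>2) < e" if "j \<ge> N" "j \<le> i" for i j
    proof -
      have "S i z - S j z = (\<Sum>n\<in>{j..<i}. c n * z ^ n)" for z
        unfolding S_def lessThan_atLeast0 using \<open>j \<le> i\<close> by (intro sum_diff_nat_ivl) auto
      then show ?thesis
        using N[OF \<open>j \<ge> N\<close>, of i] by (simp add: integral_norm_trig_poly)
    qed
    show ?thesis
    proof (intro exI allI impI)
      fix i j assume "N \<le> i" "N \<le> j"
      then show "(LINT z|circle_measure. (cmod (S i z - S j z))\<^sup>2) < e"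
        using *[of i j] *[of j i] by (cases "j \<le> i") (auto simp: norm_minus_commute)
    qed
  qed
  have "\<exists>N. \<forall>i\<ge>N. \<forall>j\<ge>N. (LINT z|circle_measure. norm (S i z - S j z)) < e" if "e > 0" for e
  proof -
    have "e\<^sup>2 > 0" using that by simp
    from cauchy[OF this] obtain N
      where N: "\<And>i j. i \<ge> N \<Longrightarrow> j \<ge> N \<Longrightarrow> (LINT z|circle_measure. (cmod (S i z - S j z))\<^sup>2) < e\<^sup>2"
      by blast
    show ?thesis
    proof (intro exI allI impI)
      fix i j assume ij: "N \<le> i" "N \<le> j"
      have d: "(\<lambda>z. S i z - S j z) \<in> L2_circle" using S by (intro L2_circle_diff)
      \<comment> \<open>Pointwise a \<le> e/2 + a^2/(2e). As the circle has total mass 1, an L2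
        distance below e gives an L1 distance below e.\<close>
      have "(LINT z|circle_measure. norm (S i z - S j z)) \<le>
          (LINT z|circle_measure. e / 2 + (cmod (S i z - S j z))\<^sup>2 / (2 * e))"
      proof (rule integral_mono)
        show "integrable circle_measure (\<lambda>z. norm (S i z - S j z))"
          using L2_circle_integrable[OF d] by (rule integrable_norm)
        show "integrable circle_measure (\<lambda>z. e / 2 + (cmod (S i z - S j z))\<^sup>2 / (2 * e))"
          using L2_circle_square_integrable[OF d] by simp
        fix z
        show "norm (S i z - S j z) \<le> e / 2 + (cmod (S i z - S j z))\<^sup>2 / (2 * e)"
          using sum_squares_bound[of e "cmod (S i z - S j z)"] \<open>e > 0\<close>
          by (simp add: field_simps power2_eq_square)
      qed
      also have "\<dots> = e / 2 + (LINT z|circle_measure. (cmod (S i z - S j z))\<^sup>2) / (2 * e)"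
        using L2_circle_square_integrable[OF d]
        by (subst Bochner_Integration.integral_add) (auto simp: measure_space_circle_measure)
      also have "\<dots> < e / 2 + e / 2"
        using N[OF ij] \<open>e > 0\<close> by (simp add: field_simps power2_eq_square)
      finally show "(LINT z|circle_measure. norm (S i z - S j z)) < e" by simp
    qed
  qed
  with L2_circle_integrable[OF S] obtain r
    where r: "strict_mono r" "AE z in circle_measure. Cauchy (\<lambda>i. S (r i) z)"
    by (rule cauchy_L1_AE_cauchy_subseq)
  define g where "g z = lim (\<lambda>i. S (r i) z)" for z
  have [measurable]: "g \<in> borel_measurable circle_measure"
    unfolding g_def by measurable
  have lim: "AE z in circle_measure. (\<lambda>i. S (r i) z) \<longlonglongrightarrow> g z"
    using r(2) by eventually_elim (simp add: g_def Cauchy_convergent_iff convergent_LIMSEQ_iff)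
  \<comment> \<open>Only S (r j) converges pointwise, so the limit is taken along the subsequence
    with i fixed; the bound for all j \<ge> N covers r j because r j \<ge> j.\<close>
  have fatou: "(\<integral>\<^sup>+z. ennreal ((cmod (S i z - g z))\<^sup>2) \<partial>circle_measure) \<le> ennreal e"
    if "\<And>j. j \<ge> N \<Longrightarrow> (LINT z|circle_measure. (cmod (S i z - S j z))\<^sup>2) < e" for i N e
  proof -
    have "(\<integral>\<^sup>+z. ennreal ((cmod (S i z - g z))\<^sup>2) \<partial>circle_measure) =
        (\<integral>\<^sup>+z. liminf (\<lambda>j. ennreal ((cmod (S i z - S (r j) z))\<^sup>2)) \<partial>circle_measure)"
    proof (rule nn_integral_cong_AE)
      show "AE z in circle_measure. ennreal ((cmod (S i z - g z))\<^sup>2) =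
          liminf (\<lambda>j. ennreal ((cmod (S i z - S (r j) z))\<^sup>2))"
        using lim
      proof eventually_elim
        case (elim z)
        then have "(\<lambda>j. ennreal ((cmod (S i z - S (r j) z))\<^sup>2)) \<longlonglongrightarrow> ennreal ((cmod (S i z - g z))\<^sup>2)"
          by (intro tendsto_intros)
        then show ?case by (rule lim_imp_Liminf[OF sequentially_bot, symmetric])
      qed
    qed
    also have "\<dots> \<le> liminf (\<lambda>j. \<integral>\<^sup>+z. ennreal ((cmod (S i z - S (r j) z))\<^sup>2) \<partial>circle_measure)"
      by (rule nn_integral_liminf) measurable
    also have "\<dots> \<le> ennreal e"
    proof (rule Liminf_le)
      have "(\<integral>\<^sup>+z. ennreal ((cmod (S i z - S (r j) z))\<^sup>2) \<partial>circle_measure) \<le> ennreal e" if "j \<ge> N" for j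
      proof -
        have "r j \<ge> N" using that seq_suble[OF r(1), of j] by simp
        have "(\<lambda>z. S i z - S (r j) z) \<in> L2_circle" using S by (intro L2_circle_diff)
        then have "(\<integral>\<^sup>+z. ennreal ((cmod (S i z - S (r j) z))\<^sup>2) \<partial>circle_measure) =
            ennreal (LINT z|circle_measure. (cmod (S i z - S (r j) z))\<^sup>2)"
          by (intro nn_integral_eq_integral L2_circle_square_integrable) auto
        also have "\<dots> \<le> ennreal e"
          using \<open>\<And>j. j \<ge> N \<Longrightarrow> _\<close>[OF \<open>r j \<ge> N\<close>] by (intro ennreal_leI) simp
        finally show ?thesis .
      qed
      then show "\<forall>\<^sub>F j in sequentially.
          (\<integral>\<^sup>+z. ennreal ((cmod (S i z - S (r j) z))\<^sup>2) \<partial>circle_measure) \<le> ennreal e"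
        by (auto simp: eventually_sequentially)
    qed simp
    finally show ?thesis .
  qed
  have Sg: "(\<lambda>z. S i z - g z) \<in> L2_circle \<and> (LINT z|circle_measure. (cmod (S i z - g z))\<^sup>2) \<le> e"
    if "\<And>j. j \<ge> N \<Longrightarrow> (LINT z|circle_measure. (cmod (S i z - S j z))\<^sup>2) < e" for i N e
  proof -
    \<comment> \<open>At j = N the hypothesis bounds a nonnegative integral, so e is nonnegative.
      Otherwise \<open>ennreal e\<close> would be truncated to 0 and the bound could not be read
      back over the reals.\<close>
    have "(LINT z|circle_measure. (cmod (S i z - S N z))\<^sup>2) \<ge> 0" by simp
    with that[of N] have "e \<ge> 0" by linarith
    have le: "(\<integral>\<^sup>+z. ennreal ((cmod (S i z - g z))\<^sup>2) \<partial>circle_measure) \<le> ennreal e"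
      using that by (rule fatou)
    have int: "integrable circle_measure (\<lambda>z. (cmod (S i z - g z))\<^sup>2)"
      using le_less_trans[OF le ennreal_less_top] by (intro integrableI_bounded) auto
    then have "(LINT z|circle_measure. (cmod (S i z - g z))\<^sup>2) \<le> e"
      using le \<open>e \<ge> 0\<close> nn_integral_eq_integral[OF int] by simp
    with int show ?thesis by (simp add: L2_circle_def)
  qed
  show thesis
  proof
    from cauchy[of 1] obtain N
      where N: "\<And>j. j \<ge> N \<Longrightarrow> (LINT z|circle_measure. (cmod (S N z - S j z))\<^sup>2) < 1"
      by auto
    have "(\<lambda>z. S N z - g z) \<in> L2_circle"
      using Sg[where N = N and i = N and e = 1] N by blast
    \<comment> \<open>Square-integrability of g itself comes from writing g = S N - (S N -
      g).\<close>
    with S[of N] have "(\<lambda>z. S N z - (S N z - g z)) \<in> L2_circle"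
      by (rule L2_circle_diff)
    then show "g \<in> L2_circle" by simp
    have "(\<lambda>i. LINT z|circle_measure. (cmod (S i z - g z))\<^sup>2) \<longlonglongrightarrow> 0"
    proof (rule LIMSEQ_I)
      fix e :: real assume "e > 0"
      with cauchy[of "e / 2"] obtain N
        where N: "\<And>i j. i \<ge> N \<Longrightarrow> j \<ge> N \<Longrightarrow> (LINT z|circle_measure. (cmod (S i z - S j z))\<^sup>2) < e / 2"
        by auto
      have "(LINT z|circle_measure. (cmod (S i z - g z))\<^sup>2) \<le> e / 2" if "i \<ge> N" for i
        using Sg[where N = N and i = i and e = "e / 2"] N[OF that] by blast
      then show "\<exists>N. \<forall>i\<ge>N. norm ((LINT z|circle_measure. (cmod (S i z - g z))\<^sup>2) - 0) < e"
        using \<open>e > 0\<close> by (intro exI[of _ N]) fastforce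
    qed
    then show "(\<lambda>N. LINT z|circle_measure. (cmod ((\<Sum>n<N. c n * z ^ n) - g z))\<^sup>2) \<longlonglongrightarrow> 0"
      by (simp add: S_def)
  qed
qed

lemma fourier_coeff_L2_limit:
  assumes g: "g \<in> L2_circle"
    and lim: "(\<lambda>N. LINT z|circle_measure. (cmod ((\<Sum>n<N. c n * z ^ n) - g z))\<^sup>2) \<longlonglongrightarrow> 0"
  shows "fourier_coeff g k = (if k \<ge> 0 then c (nat k) else 0)"
proof -
  have "(\<lambda>N. fourier_coeff (\<lambda>z. \<Sum>n<N. c n * z ^ n) k) \<longlonglongrightarrow> fourier_coeff g k"
    unfolding fourier_coeff_eq_L2_inner
    by (rule tendsto_L2_inner[OF L2_circle_trig_poly g Linf_circle_imp_L2[OF Linf_circle_powi] lim])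
  moreover have "(\<lambda>N. fourier_coeff (\<lambda>z. \<Sum>n<N. c n * z ^ n) k) \<longlonglongrightarrow> (if k \<ge> 0 then c (nat k) else 0)"
    by (rule tendsto_eventually)
       (auto simp: fourier_coeff_trig_poly eventually_sequentially intro!: exI[of _ "Suc (nat k)"])
  ultimately show ?thesis by (rule LIMSEQ_unique)
qed

lemma L2_circle_eqI:
  assumes "f \<in> L2_circle" "g \<in> L2_circle" "\<And>k. fourier_coeff f k = fourier_coeff g k"
  shows "AE z in circle_measure. f z = g z"
proof -
  have "AE z in circle_measure. f z - g z = 0"
    using assms
    by (intro fourier_coeff_zero_imp_AE_zero)
       (simp_all add: L2_circle_integrable fourier_coeff_diff)
  then show ?thesis by simp
qed

text \<open>Bessel's inequality makes the coefficients square-summable and Riesz-Fischer sums them.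
  The approximating polynomials stay in the conclusion because orthogonality relations reach all of
  \<open>H2\<close> through them.\<close>

lemma analytic_part_exists:
  assumes f: "f \<in> L2_circle"
  obtains g where "g \<in> L2_circle" "\<And>k. fourier_coeff g k = (if k \<ge> 0 then fourier_coeff f k else 0)"
    "(\<lambda>N. LINT z|circle_measure. (cmod ((\<Sum>n<N. fourier_coeff f (int n) * z ^ n) - g z))\<^sup>2) \<longlonglongrightarrow> 0"
proof -
  have "summable (\<lambda>n. (cmod (fourier_coeff f (int n)))\<^sup>2)"
    using bessel_inequality[OF f]
    by (intro summableI_nonneg_bounded[where x = "LINT z|circle_measure. (cmod (f z))\<^sup>2"]) auto
  from riesz_fischer[OF this] obtain g where g: "g \<in> L2_circle"
    "(\<lambda>N. LINT z|circle_measure. (cmod ((\<Sum>n<N. fourier_coeff f (int n) * z ^ n) - g z))\<^sup>2) \<longlonglongrightarrow> 0"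
    by blast
  with fourier_coeff_L2_limit[OF this] show thesis
    by (intro that[of g]) auto
qed

lemma H2_D:
  "f \<in> H2 \<Longrightarrow> f \<in> L2_circle" "f \<in> H2 \<Longrightarrow> k < 0 \<Longrightarrow> fourier_coeff f k = 0"
  by (auto simp: H2_def)

text \<open>By completeness h agrees almost everywhere with its analytic part, an L2 limit of
  polynomials in z. Each polynomial is orthogonal to f, since only coefficients of f at nonnegative
  indices enter.\<close>

lemma H2_orthogonal:
  assumes f: "f \<in> L2_circle" and coeff: "\<And>k. k \<ge> 0 \<Longrightarrow> fourier_coeff f k = 0" and h: "h \<in> H2"
  shows "L2_inner h f = 0"
proof -
  note hL = H2_D(1)[OF h]
  obtain g where g: "g \<in> L2_circle" "\<And>k. fourier_coeff g k = (if k \<ge> 0 then fourier_coeff h k else 0)"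
    "(\<lambda>N. LINT z|circle_measure. (cmod ((\<Sum>n<N. fourier_coeff h (int n) * z ^ n) - g z))\<^sup>2) \<longlonglongrightarrow> 0"
    by (rule analytic_part_exists[OF hL]) blast
  have "AE z in circle_measure. h z = g z"
    using hL g(1) by (rule L2_circle_eqI) (use g(2) H2_D(2)[OF h] in \<open>auto simp: not_le\<close>)
  then have "L2_inner h f = L2_inner g f"
    using hL g(1) f by (intro L2_inner_cong_AE) auto
  moreover have "L2_inner (\<lambda>z. \<Sum>n<N. fourier_coeff h (int n) * z ^ n) f = 0" for N
    by (subst L2_inner_commute) (simp add: L2_inner_trig_poly[OF f] coeff)
  then have "L2_inner g f = 0"
    using tendsto_L2_inner[OF L2_circle_trig_poly g(1) f g(3)] by (simp add: LIMSEQ_const_iff)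
  ultimately show ?thesis by simp
qed

text \<open>The analytic part of f is a witness for the choice: its difference from f has only
  negative frequencies.\<close>

lemma hardy_proj_spec:
  assumes f: "f \<in> L2_circle"
  shows "hardy_proj f \<in> H2" and "h \<in> H2 \<Longrightarrow> L2_inner (\<lambda>z. f z - hardy_proj f z) h = 0"
proof -
  obtain g where g: "g \<in> L2_circle" "\<And>k. fourier_coeff g k = (if k \<ge> 0 then fourier_coeff f k else 0)"
    by (rule analytic_part_exists[OF f]) blast
  have "g \<in> H2 \<and> (\<forall>h\<in>H2. L2_inner (\<lambda>z. f z - g z) h = 0)"
  proof (intro conjI ballI)
    show "g \<in> H2" using g by (simp add: H2_def)
    fix h assume "h \<in> H2"
    then have "L2_inner h (\<lambda>z. f z - g z) = 0"
      using f g by (intro H2_orthogonal) (auto intro: L2_circle_diff simp: fourier_coeff_diff L2_circle_integrable)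
    then show "L2_inner (\<lambda>z. f z - g z) h = 0"
      by (subst L2_inner_commute) simp
  qed
  then have "hardy_proj f \<in> H2 \<and> (\<forall>h\<in>H2. L2_inner (\<lambda>z. f z - hardy_proj f z) h = 0)"
    unfolding hardy_proj_def by (rule someI[where x = g])
  then show "hardy_proj f \<in> H2" and "h \<in> H2 \<Longrightarrow> L2_inner (\<lambda>z. f z - hardy_proj f z) h = 0"
    by auto
qed

text \<open>For k \<ge> 0 the power z^k lies in \<open>H2\<close> and can serve as a test function;
  for k < 0 membership in \<open>H2\<close> decides. The arbitrary representative thus becomes
  harmless: its coefficients are explicit.\<close>

lemma fourier_coeff_hardy_proj:
  assumes f: "f \<in> L2_circle"
  shows "fourier_coeff (hardy_proj f) k = (if k \<ge> 0 then fourier_coeff f k else 0)"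
proof (cases "k \<ge> 0")
  case True
  then have "(\<lambda>z. z powi k) \<in> H2"
    by (auto simp: H2_def fourier_coeff_powi Linf_circle_imp_L2 Linf_circle_powi)
  then have "fourier_coeff (\<lambda>z. f z - hardy_proj f z) k = 0"
    unfolding fourier_coeff_eq_L2_inner by (rule hardy_proj_spec(2)[OF f])
  then show ?thesis
    using True f H2_D(1)[OF hardy_proj_spec(1)[OF f]]
    by (simp add: fourier_coeff_diff L2_circle_integrable)
qed (use H2_D(2)[OF hardy_proj_spec(1)[OF f]] in auto)

section \<open>Vector-valued functions, Toeplitz and Hankel operators\<close>

definition L2_vec :: "(complex \<Rightarrow> complex^'n) set" where
  "L2_vec = {f. \<forall>i. (\<lambda>z. f z $ i) \<in> L2_circle}"

definition vec_coeff :: "(complex \<Rightarrow> complex^'n) \<Rightarrow> int \<Rightarrow> complex^'n" where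
  "vec_coeff f k = (\<chi> i. fourier_coeff (\<lambda>z. f z $ i) k)"

definition mat_coeff :: "(complex \<Rightarrow> complex^'n^'m) \<Rightarrow> int \<Rightarrow> complex^'n^'m" where
  "mat_coeff F k = (\<chi> i j. fourier_coeff (\<lambda>z. F z $ i $ j) k)"

lemma analytic_mat_iff: "analytic_mat F \<longleftrightarrow> (\<forall>k<0. mat_coeff F k = 0)"
  by (simp add: analytic_mat_def mat_coeff_def vec_eq_iff)

lemma H2_vec_iff: "h \<in> H2_vec \<longleftrightarrow> h \<in> L2_vec \<and> (\<forall>k<0. vec_coeff h k = 0)"
  by (auto simp: H2_vec_def H2_def L2_vec_def vec_coeff_def vec_eq_iff)

lemma H2_vec_L2: "h \<in> H2_vec \<Longrightarrow> h \<in> L2_vec"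
  by (simp add: H2_vec_iff)

lemma L2_vec_const: "(\<lambda>z. c) \<in> L2_vec"
  by (simp add: L2_vec_def L2_circle_const)

lemma L2_vec_add: "f \<in> L2_vec \<Longrightarrow> g \<in> L2_vec \<Longrightarrow> (\<lambda>z. f z + g z) \<in> L2_vec"
  by (simp add: L2_vec_def L2_circle_add)

lemma L2_vec_diff: "f \<in> L2_vec \<Longrightarrow> g \<in> L2_vec \<Longrightarrow> (\<lambda>z. f z - g z) \<in> L2_vec"
  by (simp add: L2_vec_def L2_circle_diff)

lemma L2_vec_powi: "f \<in> L2_vec \<Longrightarrow> (\<lambda>z. z powi k *s f z) \<in> L2_vec"
  by (simp add: L2_vec_def L2_circle_mult Linf_circle_powi)

lemma L2_vec_comp_cnj: "f \<in> L2_vec \<Longrightarrow> (\<lambda>z. f (cnj z)) \<in> L2_vec"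
  using L2_circle_comp_cnj[where f = "\<lambda>z. f z $ i" for i] by (simp add: L2_vec_def)

lemma L2_vec_mat: "F \<in> Linf_mat \<Longrightarrow> f \<in> L2_vec \<Longrightarrow> (\<lambda>z. F z *v f z) \<in> L2_vec"
  by (simp add: L2_vec_def Linf_mat_def matrix_vector_mult_def L2_circle_sum L2_circle_mult)

lemma Linf_mat_const: "(\<lambda>z. A) \<in> Linf_mat"
  by (simp add: Linf_mat_def Linf_circle_const)

lemma Linf_mat_mult: "F \<in> Linf_mat \<Longrightarrow> G \<in> Linf_mat \<Longrightarrow> (\<lambda>z. F z ** G z) \<in> Linf_mat"
  by (simp add: Linf_mat_def matrix_matrix_mult_def Linf_circle_sum Linf_circle_mult)

lemma Linf_mat_add: "F \<in> Linf_mat \<Longrightarrow> G \<in> Linf_mat \<Longrightarrow> (\<lambda>z. F z + G z) \<in> Linf_mat"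
  by (simp add: Linf_mat_def Linf_circle_add)

lemma Linf_mat_diff: "F \<in> Linf_mat \<Longrightarrow> G \<in> Linf_mat \<Longrightarrow> (\<lambda>z. F z - G z) \<in> Linf_mat"
  by (simp add: Linf_mat_def Linf_circle_diff)

lemma Linf_mat_comp_cnj: "F \<in> Linf_mat \<Longrightarrow> (\<lambda>z. F (cnj z)) \<in> Linf_mat"
  using Linf_circle_comp_cnj[where f = "\<lambda>z. F z $ i $ j" for i j] by (simp add: Linf_mat_def)

lemma Linf_mat_tilde: "F \<in> Linf_mat \<Longrightarrow> tilde F \<in> Linf_mat"
  using Linf_circle_cnj[OF Linf_circle_comp_cnj[where f = "\<lambda>z. F z $ i $ j" for i j]]
  by (simp add: Linf_mat_def tilde_def cmat_adjoint_def)

lemma L2_vec_integrable: "f \<in> L2_vec \<Longrightarrow> integrable circle_measure (\<lambda>z. f z $ i)"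
  by (simp add: L2_vec_def L2_circle_integrable)

lemma L2_vec_measurable: "f \<in> L2_vec \<Longrightarrow> (\<lambda>z. f z $ i) \<in> borel_measurable circle_measure"
  by (simp add: L2_vec_def L2_circle_measurable)

lemma Linf_mat_integrable: "F \<in> Linf_mat \<Longrightarrow> integrable circle_measure (\<lambda>z. F z $ i $ j)"
  by (simp add: Linf_mat_def L2_circle_integrable Linf_circle_imp_L2)

lemma vec_coeff_add:
  "f \<in> L2_vec \<Longrightarrow> g \<in> L2_vec \<Longrightarrow> vec_coeff (\<lambda>z. f z + g z) k = vec_coeff f k + vec_coeff g k"
  by (simp add: vec_coeff_def vec_eq_iff fourier_coeff_add L2_vec_integrable)

lemma vec_coeff_diff:
  "f \<in> L2_vec \<Longrightarrow> g \<in> L2_vec \<Longrightarrow> vec_coeff (\<lambda>z. f z - g z) k = vec_coeff f k - vec_coeff g k"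
  by (simp add: vec_coeff_def vec_eq_iff fourier_coeff_diff L2_vec_integrable)

lemma vec_coeff_const: "vec_coeff (\<lambda>z. c) k = (if k = 0 then c else 0)"
  by (simp add: vec_coeff_def vec_eq_iff fourier_coeff_const)

lemma vec_coeff_powi: "vec_coeff (\<lambda>z. z powi j *s f z) k = vec_coeff f (k - j)"
  by (simp add: vec_coeff_def vec_eq_iff fourier_coeff_powi_mult)

lemma vec_coeff_mat:
  "f \<in> L2_vec \<Longrightarrow> vec_coeff (\<lambda>z. A *v f z) k = A *v vec_coeff f k"
  by (simp add: vec_coeff_def vec_eq_iff matrix_vector_mult_def fourier_coeff_sum
      fourier_coeff_cmult L2_vec_integrable)

lemma vec_coeff_mat_const:
  assumes "F \<in> Linf_mat"
  shows "vec_coeff (\<lambda>z. F z *v c) k = mat_coeff F k *v c"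
  using assms
  by (simp add: vec_coeff_def mat_coeff_def vec_eq_iff matrix_vector_mult_def fourier_coeff_sum
      fourier_coeff_cmult Linf_mat_integrable mult.commute[of _ "c $ _"])

lemma vec_coeff_comp_cnj:
  assumes "f \<in> L2_vec"
  shows "vec_coeff (\<lambda>z. f (cnj z)) k = vec_coeff f (- k)"
proof -
  have "fourier_coeff (\<lambda>z. f (cnj z) $ i) k = fourier_coeff (\<lambda>z. f z $ i) (- k)" for i
    by (rule fourier_coeff_comp_cnj[OF L2_vec_measurable[OF assms]])
  then show ?thesis by (simp add: vec_coeff_def)
qed

lemma vec_coeff_cong:
  assumes "\<And>z. z \<in> sphere 0 1 \<Longrightarrow> f z = g z"
  shows "vec_coeff f k = vec_coeff g k"
proof -
  have "fourier_coeff (\<lambda>z. f z $ i) k = fourier_coeff (\<lambda>z. g z $ i) k" for i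
    using assms by (intro fourier_coeff_cong) simp
  then show ?thesis by (simp add: vec_coeff_def)
qed

lemma vec_coeff_cong_AE:
  assumes "AE z in circle_measure. f z = g z" "f \<in> L2_vec" "g \<in> L2_vec"
  shows "vec_coeff f k = vec_coeff g k"
proof -
  have "fourier_coeff (\<lambda>z. f z $ i) k = fourier_coeff (\<lambda>z. g z $ i) k" for i
    using assms by (intro fourier_coeff_cong_AE L2_vec_measurable) auto
  then show ?thesis by (simp add: vec_coeff_def)
qed

lemma L2_vec_eqI:
  fixes f g :: "complex \<Rightarrow> complex^'n"
  assumes "f \<in> L2_vec" "g \<in> L2_vec" "\<And>k. vec_coeff f k = vec_coeff g k"
  shows "AE z in circle_measure. f z = g z"
proof -
  have "AE z in circle_measure. f z $ i = g z $ i" for i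
    using assms by (intro L2_circle_eqI) (auto simp: L2_vec_def vec_coeff_def vec_eq_iff)
  then have "AE z in circle_measure. \<forall>i\<in>UNIV. f z $ i = g z $ i"
    by (intro AE_finite_allI) auto
  then show ?thesis by (simp add: vec_eq_iff)
qed

text \<open>Allows an identity valid only almost everywhere to be substituted under multiplication
  by a symbol.\<close>

lemma vec_coeff_mat_cong_AE:
  assumes "AE z in circle_measure. f z = g z" "f \<in> L2_vec" "g \<in> L2_vec" "F \<in> Linf_mat"
  shows "vec_coeff (\<lambda>z. F z *v f z) k = vec_coeff (\<lambda>z. F z *v g z) k"
  using assms by (intro vec_coeff_cong_AE L2_vec_mat) auto

lemma L2_vec_flip:
  assumes "f \<in> L2_vec"
  shows "(\<lambda>z. cnj z *s f (cnj z)) \<in> L2_vec"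
proof -
  have "(\<lambda>z. cnj z * f (cnj z) $ i) \<in> L2_circle" for i
    using L2_vec_comp_cnj[OF assms] Linf_circle_cnj[OF Linf_circle_powi[of 1]]
    by (intro L2_circle_mult) (auto simp: L2_vec_def)
  then show ?thesis by (simp add: L2_vec_def)
qed

text \<open>The index map k to -k-1 exchanges the nonnegative and the negative integers. Hence a
  Hankel operator lists the coefficients at -1, -2, ... of symbol times argument.\<close>

lemma vec_coeff_flip:
  assumes "f \<in> L2_vec"
  shows "vec_coeff (\<lambda>z. cnj z *s f (cnj z)) k = vec_coeff f (- k - 1)"
proof -
  have "vec_coeff (\<lambda>z. cnj z *s f (cnj z)) k = vec_coeff (\<lambda>z. z powi (-1) *s f (cnj z)) k"
    by (intro vec_coeff_cong) (simp add: cnj_circle power_int_minus)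
  also have "\<dots> = vec_coeff f (- k - 1)"
    unfolding vec_coeff_powi vec_coeff_comp_cnj[OF assms] by (rule arg_cong[where f = "vec_coeff f"]) simp
  finally show ?thesis .
qed

section \<open>Coefficients of Toeplitz and Hankel operators\<close>

lemma hardy_proj_vec_H2: "f \<in> L2_vec \<Longrightarrow> hardy_proj_vec f \<in> H2_vec"
  by (simp add: hardy_proj_vec_def H2_vec_def L2_vec_def hardy_proj_spec)

lemma vec_coeff_hardy_proj:
  "f \<in> L2_vec \<Longrightarrow> vec_coeff (hardy_proj_vec f) k = (if k \<ge> 0 then vec_coeff f k else 0)"
  using fourier_coeff_hardy_proj[of "\<lambda>z. f z $ _" k]
  by (simp add: hardy_proj_vec_def vec_coeff_def L2_vec_def vec_eq_iff)

lemma toeplitz_H2: "F \<in> Linf_mat \<Longrightarrow> h \<in> L2_vec \<Longrightarrow> toeplitz F h \<in> H2_vec"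
  unfolding toeplitz_def by (intro hardy_proj_vec_H2 L2_vec_mat)

lemma vec_coeff_toeplitz:
  "F \<in> Linf_mat \<Longrightarrow> h \<in> L2_vec \<Longrightarrow>
    vec_coeff (toeplitz F h) k = (if k \<ge> 0 then vec_coeff (\<lambda>z. F z *v h z) k else 0)"
  unfolding toeplitz_def by (intro vec_coeff_hardy_proj L2_vec_mat)

lemma hankel_H2: "F \<in> Linf_mat \<Longrightarrow> h \<in> L2_vec \<Longrightarrow> hankel F h \<in> H2_vec"
  unfolding hankel_def by (intro hardy_proj_vec_H2 L2_vec_flip L2_vec_mat)

lemma vec_coeff_hankel:
  "F \<in> Linf_mat \<Longrightarrow> h \<in> L2_vec \<Longrightarrow>
    vec_coeff (hankel F h) k = (if k \<ge> 0 then vec_coeff (\<lambda>z. F z *v h z) (- k - 1) else 0)"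
  unfolding hankel_def
  by (simp only: vec_coeff_hardy_proj[OF L2_vec_flip[OF L2_vec_mat]] vec_coeff_flip[OF L2_vec_mat])

text \<open>The coefficient is the inner product of h with z^k times the conjugate of a. For k < 0
  and a analytic, that function has only negative frequencies, so it is orthogonal to
  \<open>H2\<close> and no convolution is required.\<close>

lemma fourier_coeff_analytic_mult:
  assumes a: "a \<in> Linf_circle" "\<And>k. k < 0 \<Longrightarrow> fourier_coeff a k = 0"
    and h: "h \<in> H2" and k: "k < 0"
  shows "fourier_coeff (\<lambda>z. a z * h z) k = 0"
proof -
  have "fourier_coeff (\<lambda>z. a z * h z) k = L2_inner h (\<lambda>z. z powi k * cnj (a z))"
    unfolding fourier_coeff_def L2_inner_def
    by (intro Bochner_Integration.integral_cong) (auto simp: cnj_powi_circle)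
  also have "\<dots> = 0"
  proof (rule H2_orthogonal[OF _ _ h])
    show "(\<lambda>z. z powi k * cnj (a z)) \<in> L2_circle"
      by (intro L2_circle_mult L2_circle_cnj Linf_circle_imp_L2 Linf_circle_powi a)
    show "fourier_coeff (\<lambda>z. z powi k * cnj (a z)) m = 0" if "m \<ge> 0" for m
      using a(2)[of "k - m"] k that by (simp add: fourier_coeff_powi_mult fourier_coeff_cnj)
  qed
  finally show ?thesis .
qed

lemma vec_coeff_analytic_mult:
  assumes F: "F \<in> Linf_mat" "analytic_mat F" and h: "h \<in> H2_vec" and k: "k < 0"
  shows "vec_coeff (\<lambda>z. F z *v h z) k = 0"
proof -
  have "fourier_coeff (\<lambda>z. \<Sum>j\<in>UNIV. F z $ i $ j * h z $ j) k = 0" for i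
  proof (subst fourier_coeff_sum)
    show "integrable circle_measure (\<lambda>z. F z $ i $ j * h z $ j)" for j
      using F h by (intro L2_circle_integrable L2_circle_mult) (auto simp: Linf_mat_def H2_vec_def H2_def)
    show "(\<Sum>j\<in>UNIV. fourier_coeff (\<lambda>z. F z $ i $ j * h z $ j) k) = 0"
      using F h k
      by (intro sum.neutral ballI fourier_coeff_analytic_mult)
         (auto simp: Linf_mat_def H2_vec_def analytic_mat_def)
  qed
  then show ?thesis
    by (simp add: vec_coeff_def vec_eq_iff matrix_vector_mult_def)
qed

section \<open>Adjoints of Hankel operators\<close>

lemma L2_inner_hardy_proj:
  assumes "f \<in> L2_circle" "h \<in> H2"
  shows "L2_inner (hardy_proj f) h = L2_inner f h"
  using hardy_proj_spec(2)[OF assms]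
    L2_inner_diff_left[OF assms(1) H2_D(1)[OF hardy_proj_spec(1)[OF assms(1)]] H2_D(1)[OF assms(2)]]
  by simp

lemma L2_inner_vec_hardy_proj:
  assumes "f \<in> L2_vec" "h \<in> H2_vec"
  shows "L2_inner_vec (hardy_proj_vec f) h = L2_inner_vec f h"
  using assms unfolding L2_inner_vec_def hardy_proj_vec_def
  by (simp add: L2_inner_hardy_proj L2_vec_def H2_vec_def)

lemma L2_inner_vec_commute: "L2_inner_vec g f = cnj (L2_inner_vec f g)"
  unfolding L2_inner_vec_def cnj_sum by (intro sum.cong refl L2_inner_commute)

lemma L2_inner_vec_eq_integral:
  assumes "f \<in> L2_vec" "g \<in> L2_vec"
  shows "L2_inner_vec f g = (LINT z|circle_measure. (\<Sum>i\<in>UNIV. f z $ i * cnj (g z $ i)))"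
  using assms unfolding L2_inner_vec_def L2_inner_def L2_vec_def
  by (subst Bochner_Integration.integral_sum) (auto intro!: L2_inner_integrable)

text \<open>The projection disappears against a function in \<open>H2_vec\<close>, on either side of
  the inner product. What remains is a change of variable by conjugation, which carries the symbol
  across as \<open>tilde F\<close>.\<close>

lemma hankel_adjoint:
  fixes F :: "complex \<Rightarrow> complex^'n^'n"
  assumes F: "F \<in> Linf_mat" and k: "k \<in> H2_vec" and h: "h \<in> H2_vec"
  shows "L2_inner_vec (hankel F k) h = L2_inner_vec k (hankel (tilde F) h)"
proof -
  note L = H2_vec_L2[OF k] H2_vec_L2[OF h] and F' = Linf_mat_tilde[OF F]
  define u where "u z = cnj z *s (F (cnj z) *v k (cnj z))" for z
  define w where "w z = cnj z *s (tilde F (cnj z) *v h (cnj z))" for z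
  have u: "u \<in> L2_vec" and w: "w \<in> L2_vec"
    unfolding u_def[abs_def] w_def[abs_def]
    using L2_vec_flip[OF L2_vec_mat[OF F L(1)]] L2_vec_flip[OF L2_vec_mat[OF F' L(2)]] by auto
  \<comment> \<open>The left integrand is evaluated at \<open>cnj z\<close>, so that F stands at z,
    where \<open>tilde F (cnj z)\<close> is its adjoint.\<close>
  have eq: "(\<Sum>i\<in>UNIV. u (cnj z) $ i * cnj (h (cnj z) $ i)) = (\<Sum>j\<in>UNIV. k z $ j * cnj (w z $ j))" for z
  proof -
    have "(\<Sum>i\<in>UNIV. u (cnj z) $ i * cnj (h (cnj z) $ i)) =
        (\<Sum>i\<in>UNIV. \<Sum>j\<in>UNIV. z * F z $ i $ j * k z $ j * cnj (h (cnj z) $ i))"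
      by (simp add: u_def matrix_vector_mult_def sum_distrib_left sum_distrib_right mult.assoc)
    also have "\<dots> = (\<Sum>j\<in>UNIV. \<Sum>i\<in>UNIV. z * F z $ i $ j * k z $ j * cnj (h (cnj z) $ i))"
      by (rule sum.swap)
    also have "\<dots> = (\<Sum>j\<in>UNIV. k z $ j * cnj (w z $ j))"
      by (simp add: w_def matrix_vector_mult_def tilde_def cmat_adjoint_def sum_distrib_left
          sum_distrib_right mult_ac)
    finally show ?thesis .
  qed
  have "(\<lambda>z. \<Sum>i\<in>UNIV. u z $ i * cnj (h z $ i)) \<in> borel_measurable circle_measure"
    using L2_vec_measurable[OF u] L2_vec_measurable[OF L(2)] by measurable
  from integral_cnj_circle[OF this] have "L2_inner_vec u h = L2_inner_vec k w"
    by (simp add: L2_inner_vec_eq_integral u w L eq)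
  moreover have "L2_inner_vec (hankel F k) h = L2_inner_vec u h"
    unfolding hankel_def u_def[symmetric] by (rule L2_inner_vec_hardy_proj[OF u h])
  moreover have "L2_inner_vec k (hankel (tilde F) h) = L2_inner_vec k w"
    unfolding hankel_def w_def[symmetric]
    by (subst (1 2) L2_inner_vec_commute) (simp add: L2_inner_vec_hardy_proj[OF w k])
  ultimately show ?thesis by simp
qed

text \<open>Test functions that isolate one entry of one coefficient; they identify an adjoint from
  its inner products.\<close>

lemma L2_inner_vec_axis:
  "L2_inner_vec (\<lambda>z. axis i (z powi m)) g = cnj (vec_coeff g m $ i)"
proof -
  have "L2_inner_vec (\<lambda>z. axis i (z powi m)) g =
      (\<Sum>j\<in>UNIV. if j = i then L2_inner (\<lambda>z. z powi m) (\<lambda>z. g z $ i) else 0)"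
    unfolding L2_inner_vec_def
    by (intro sum.cong) (auto simp: axis_def L2_inner_def)
  also have "\<dots> = cnj (vec_coeff g m $ i)"
    using L2_inner_commute[of "\<lambda>z. z powi m"] by (simp add: vec_coeff_def fourier_coeff_eq_L2_inner)
  finally show ?thesis .
qed

lemma H2_vec_axis: "m \<ge> 0 \<Longrightarrow> (\<lambda>z. axis i (z powi m)) \<in> H2_vec"
proof -
  assume "m \<ge> 0"
  then have "(\<lambda>z. z powi m) \<in> H2" "(\<lambda>z. 0) \<in> H2"
    by (auto simp: H2_def fourier_coeff_powi Linf_circle_imp_L2 Linf_circle_powi L2_circle_const)
  then have "(\<lambda>z. axis i (z powi m) $ j) \<in> H2" for j
    by (cases "j = i") (simp_all add: axis_def)
  then show ?thesis by (simp add: H2_vec_def)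
qed

text \<open>The Hankel operator of \<open>tilde F\<close> shows that the choice has a witness.
  Whatever is chosen has the same inner products with each z^m times a basis vector, m \<ge> 0,
  hence the same coefficients.\<close>

lemma hardy_adjoint_hankel:
  fixes F :: "complex \<Rightarrow> complex^'n^'n"
  assumes F: "F \<in> Linf_mat" and h: "h \<in> H2_vec"
  shows "hardy_adjoint (hankel F) h \<in> H2_vec"
    and "AE z in circle_measure. hardy_adjoint (hankel F) h z = hankel (tilde F) h z"
proof -
  let ?g = "hardy_adjoint (hankel F) h"
  have H: "hankel (tilde F) h \<in> H2_vec"
    by (rule hankel_H2[OF Linf_mat_tilde[OF F] H2_vec_L2[OF h]])
  have "?g \<in> H2_vec \<and> (\<forall>k\<in>H2_vec. L2_inner_vec (hankel F k) h = L2_inner_vec k ?g)"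
    unfolding hardy_adjoint_def
    by (rule someI[where x = "hankel (tilde F) h"]) (use H hankel_adjoint[OF F _ h] in blast)
  then have g: "?g \<in> H2_vec"
    and adj: "\<And>k. k \<in> H2_vec \<Longrightarrow> L2_inner_vec k ?g = L2_inner_vec k (hankel (tilde F) h)"
    using hankel_adjoint[OF F _ h] by auto
  show "?g \<in> H2_vec" by fact
  show "AE z in circle_measure. ?g z = hankel (tilde F) h z"
  proof (rule L2_vec_eqI)
    show "?g \<in> L2_vec" "hankel (tilde F) h \<in> L2_vec" using g H by (auto intro: H2_vec_L2)
    show "vec_coeff ?g k = vec_coeff (hankel (tilde F) h) k" for k
    proof (cases "k \<ge> 0")
      case True
      then show ?thesis
        using adj[OF H2_vec_axis[OF True]] by (simp add: L2_inner_vec_axis vec_eq_iff)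
    next
      case False
      then show ?thesis using g H by (simp add: H2_vec_iff)
    qed
  qed
qed

section \<open>The commutation relation\<close>

lemma mat_coeff_eqI:
  assumes "F \<in> Linf_mat" "\<And>c. vec_coeff (\<lambda>z. F z *v c) k = M *v c"
  shows "mat_coeff F k = M"
  using assms by (simp add: matrix_eq vec_coeff_mat_const)

lemma mat_coeff_cmat_adjoint:
  "mat_coeff (\<lambda>z. cmat_adjoint (F z)) k = cmat_adjoint (mat_coeff F (- k))"
  by (simp add: mat_coeff_def cmat_adjoint_def vec_eq_iff fourier_coeff_cnj)

lemma vec_coeff_mat_powi:
  assumes "F \<in> Linf_mat"
  shows "vec_coeff (\<lambda>z. F z *v (z powi j *s c)) k = mat_coeff F (k - j) *v c"
  using assms by (simp add: vector_scalar_commute vec_coeff_powi vec_coeff_mat_const)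

lemma vec_coeff_minus: "vec_coeff (\<lambda>z. - f z) k = - vec_coeff f k"
  by (simp add: vec_coeff_def vec_eq_iff fourier_coeff_minus)

lemma L2_vec_uminus: "f \<in> L2_vec \<Longrightarrow> (\<lambda>z. - f z) \<in> L2_vec"
  by (simp add: L2_vec_def L2_circle_minus)

lemma H2_vec_powi:
  assumes "j \<ge> 0"
  shows "(\<lambda>z. z powi j *s c) \<in> H2_vec"
  using assms L2_vec_powi[OF L2_vec_const[of c], of j]
  by (simp add: H2_vec_iff vec_coeff_powi vec_coeff_const)

text \<open>Both sides lie in \<open>H2_vec\<close>, so only coefficients at i \<ge> 0 matter. The
  outer Hankel operator moves the index to -i-1, and the chosen adjoint is replaced by its explicit
  form under \<open>\<phi>\<close>.\<close>

lemma commutation_iff: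
  fixes \<phi> \<psi> :: "complex \<Rightarrow> complex^'n^'n"
  assumes \<phi>: "\<phi> \<in> Linf_mat" and \<psi>: "\<psi> \<in> Linf_mat" and h: "h \<in> H2_vec"
  shows "(AE z in circle_measure.
            toeplitz \<phi> (hardy_adjoint (hankel \<psi>) h) z = hankel \<psi> (toeplitz \<phi> h) z) \<longleftrightarrow>
         (\<forall>i\<ge>0. vec_coeff (\<lambda>z. \<phi> z *v hankel (tilde \<psi>) h z) i =
                 vec_coeff (\<lambda>z. \<psi> z *v toeplitz \<phi> h z) (- i - 1))"
proof -
  note adj = hardy_adjoint_hankel[OF \<psi> h]
  note K = H2_vec_L2[OF hankel_H2[OF Linf_mat_tilde[OF \<psi>] H2_vec_L2[OF h]]]
  note T = H2_vec_L2[OF toeplitz_H2[OF \<phi> H2_vec_L2[OF h]]]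
  note lhs = H2_vec_L2[OF toeplitz_H2[OF \<phi> H2_vec_L2[OF adj(1)]]]
  note rhs = H2_vec_L2[OF hankel_H2[OF \<psi> T]]
  have "(AE z in circle_measure.
            toeplitz \<phi> (hardy_adjoint (hankel \<psi>) h) z = hankel \<psi> (toeplitz \<phi> h) z) \<longleftrightarrow>
        (\<forall>k. vec_coeff (toeplitz \<phi> (hardy_adjoint (hankel \<psi>) h)) k =
             vec_coeff (hankel \<psi> (toeplitz \<phi> h)) k)"
    using L2_vec_eqI[OF lhs rhs] vec_coeff_cong_AE[OF _ lhs rhs] by blast
  also have "\<dots> \<longleftrightarrow> (\<forall>i\<ge>0. vec_coeff (\<lambda>z. \<phi> z *v hankel (tilde \<psi>) h z) i =
                 vec_coeff (\<lambda>z. \<psi> z *v toeplitz \<phi> h z) (- i - 1))"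
    using vec_coeff_mat_cong_AE[OF adj(2) H2_vec_L2[OF adj(1)] K \<phi>]
    by (simp add: vec_coeff_toeplitz[OF \<phi> H2_vec_L2[OF adj(1)]] vec_coeff_hankel[OF \<psi> T])
  finally show ?thesis .
qed

section \<open>Linear algebra: extracting the common matrix factor\<close>

lemma matrix_vector_mult_uminus:
  fixes A :: "complex^'n^'m"
  shows "A *v (- x) = - (A *v x)"
  by (simp add: matrix_vector_mult_def vec_eq_iff sum_negf)

text \<open>Here \<open>inner\<close> is the real inner product, the real part of the Hermitian one.
  The adjoint rule survives taking real parts, which makes real orthogonal complements usable for
  complex matrices.\<close>

lemma inner_cmat_adjoint:
  fixes W :: "complex^'n^'m"
  shows "inner c (W *v v) = inner (cmat_adjoint W *v c) v"
proof -
  have inner_Re: "inner x y = Re (\<Sum>i\<in>UNIV. cnj (x $ i) * y $ i)" for x y :: "complex^'k::finite"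
    by (simp add: inner_vec_def inner_complex_def)
  have "(\<Sum>i\<in>UNIV. cnj (c $ i) * (W *v v) $ i) = (\<Sum>i\<in>UNIV. \<Sum>j\<in>UNIV. cnj (c $ i) * W $ i $ j * v $ j)"
    by (simp add: matrix_vector_mult_def sum_distrib_left mult.assoc)
  also have "\<dots> = (\<Sum>j\<in>UNIV. \<Sum>i\<in>UNIV. cnj (c $ i) * W $ i $ j * v $ j)"
    by (rule sum.swap)
  also have "\<dots> = (\<Sum>j\<in>UNIV. cnj ((cmat_adjoint W *v c) $ j) * v $ j)"
    by (simp add: matrix_vector_mult_def cmat_adjoint_def sum_distrib_left mult_ac)
  finally show ?thesis by (simp only: inner_Re)
qed

text \<open>A proper subspace has a nonzero normal vector c. Orthogonality to all ranges puts c into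
  the kernel of every adjoint, although subspace and orthogonality are meant over the reals.\<close>

lemma subspace_eq_UNIV_if_contains_ranges:
  fixes U :: "(complex^'n) set" and W :: "'j \<Rightarrow> complex^'m^'n"
  assumes U: "subspace U" and W: "\<And>j v. W j *v v \<in> U"
    and ker: "\<And>c. (\<And>j. cmat_adjoint (W j) *v c = 0) \<Longrightarrow> c = 0"
  shows "U = UNIV"
proof (rule ccontr)
  assume "U \<noteq> UNIV"
  then have "dim U < DIM(complex^'n)"
    using U by (metis dim_eq_full dim_subset_UNIV le_neq_implies_less span_eq_iff)
  then obtain c where c: "c \<noteq> 0" "\<And>w. w \<in> span U \<Longrightarrow> orthogonal c w"
    by (rule orthogonal_to_subspace_exists) blast
  have "cmat_adjoint (W j) *v c = 0" for j
  proof -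
    \<comment> \<open>For this test vector the real inner product is the squared norm of the adjoint
      applied to c, so its vanishing suffices.\<close>
    have "inner c (W j *v (cmat_adjoint (W j) *v c)) = 0"
      using c(2)[OF span_base[OF W]] by (simp add: orthogonal_def)
    then show ?thesis
      unfolding inner_cmat_adjoint[of c "W j"] by simp
  qed
  with ker c(1) show False by blast
qed

text \<open>For w = W j v the relation reads Z i w = X i (- Y j v), where the vector on the right
  does not depend on i. The w that admit such a common solution form a subspace containing all
  ranges, hence everything. With Z i = X i A the relation becomes X i (Y j + A W j) = 0 for all i,
  and the trivial common kernel gives the rest.\<close>

lemma common_factor_exists:
  fixes X Z :: "'i \<Rightarrow> complex^'n^'m" and W :: "'j \<Rightarrow> complex^'k^'n" and Y :: "'j \<Rightarrow> complex^'k^'n"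
  assumes eq: "\<And>i j. X i ** Y j + Z i ** W j = 0"
    and X: "\<And>c. (\<And>i. X i *v c = 0) \<Longrightarrow> c = 0"
    and W: "\<And>c. (\<And>j. cmat_adjoint (W j) *v c = 0) \<Longrightarrow> c = 0"
  shows "\<exists>A. (\<forall>i. Z i = X i ** A) \<and> (\<forall>j. Y j + A ** W j = 0)"
proof -
  define U where "U = {w. \<exists>y. \<forall>i. Z i *v w = X i *v y}"
  have "subspace U"
  proof (rule subspaceI)
    have "\<forall>i. Z i *v 0 = X i *v 0" by simp
    then show "0 \<in> U" unfolding U_def by blast
    show "v + w \<in> U" if vw: "v \<in> U" "w \<in> U" for v w
    proof -
      obtain x y where "\<forall>i. Z i *v v = X i *v x" "\<forall>i. Z i *v w = X i *v y"
        using vw unfolding U_def by blast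
      then have "\<forall>i. Z i *v (v + w) = X i *v (x + y)"
        by (simp add: matrix_vector_right_distrib)
      then show ?thesis unfolding U_def by blast
    qed
    show "r *\<^sub>R w \<in> U" if w: "w \<in> U" for r w
    proof -
      obtain y where "\<forall>i. Z i *v w = X i *v y"
        using w unfolding U_def by blast
      moreover have "M *v (r *\<^sub>R x) = r *\<^sub>R (M *v x)" for M :: "complex^'n^'m" and x
        by (simp add: matrix_vector_mult_def vec_eq_iff scaleR_sum_right)
      ultimately have "\<forall>i. Z i *v (r *\<^sub>R w) = X i *v (r *\<^sub>R y)" by simp
      then show ?thesis unfolding U_def by blast
    qed
  qed
  moreover have "W j *v v \<in> U" for j v
  proof -
    have "X i *v (Y j *v v) + Z i *v (W j *v v) = 0" for i
      using arg_cong[OF eq[of i j], of "\<lambda>M. M *v v"]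
      by (simp add: matrix_vector_mult_add_rdistrib matrix_vector_mul_assoc)
    then have "Z i *v (W j *v v) = X i *v (- (Y j *v v))" for i
      by (simp add: eq_neg_iff_add_eq_0 add.commute matrix_vector_mult_uminus)
    then show ?thesis unfolding U_def by blast
  qed
  ultimately have "U = UNIV"
    using W by (rule subspace_eq_UNIV_if_contains_ranges)
  then have "\<forall>l. \<exists>y. \<forall>i. Z i *v axis l 1 = X i *v y"
    unfolding U_def by blast
  from choice[OF this] obtain y where y: "\<And>l i. Z i *v axis l 1 = X i *v y l"
    by blast
  \<comment> \<open>Column l of A is the solution selected for the l-th basis vector; choosing on a
    basis only makes the assignment linear.\<close>
  define A :: "complex^'n^'n" where "A = (\<chi> k l. y l $ k)"
  have ZA: "Z i = X i ** A" for i
  proof -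
    have "Z i $ a $ b = (X i ** A) $ a $ b" for a b
    proof -
      have "Z i $ a $ b = (Z i *v axis b 1) $ a"
        by (simp add: matrix_vector_mult_def axis_def if_distrib cong: if_cong)
      also have "\<dots> = (X i ** A) $ a $ b"
        unfolding y by (simp add: A_def matrix_matrix_mult_def matrix_vector_mult_def)
      finally show ?thesis .
    qed
    then show ?thesis by (simp add: vec_eq_iff)
  qed
  moreover have "Y j + A ** W j = 0" for j
  proof -
    have "X i *v ((Y j + A ** W j) *v c) = 0" for i c
    proof -
      have "X i ** (Y j + A ** W j) = 0"
        using eq[of i j] by (simp add: ZA matrix_add_ldistrib matrix_mul_assoc)
      then show ?thesis by (simp add: matrix_vector_mul_assoc)
    qed
    then have "(Y j + A ** W j) *v c = 0" for c by (rule X)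
    then show ?thesis by (simp add: matrix_eq)
  qed
  ultimately show ?thesis by blast
qed

text \<open>The coefficients of P(cnj z F) at 0, 1, ... are those of F at 1, 2, .... A vector killed
  by all of these annihilates P(cnj z F) almost everywhere, which is a linear dependence among its
  columns.\<close>

lemma regular_proj_kernel:
  fixes F :: "complex \<Rightarrow> complex^'n^'n"
  assumes F: "F \<in> Linf_mat"
    and reg: "regular_mat (hardy_proj_mat (\<lambda>z. \<chi> i j. cnj z * F z $ i $ j))"
    and c: "\<And>k. k > 0 \<Longrightarrow> mat_coeff F k *v c = 0"
  shows "c = 0"
proof -
  define G where "G = hardy_proj_mat (\<lambda>z. \<chi> i j. cnj z * F z $ i $ j)"
  have G: "(\<lambda>z. G z $ i $ j) = hardy_proj (\<lambda>z. cnj z * F z $ i $ j)" for i j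
    by (simp add: G_def hardy_proj_mat_def)
  have zF: "(\<lambda>z. cnj z * F z $ i $ j) \<in> L2_circle" for i j
    using F Linf_circle_cnj[OF Linf_circle_powi[of 1]]
    by (intro L2_circle_mult) (auto simp: Linf_mat_def Linf_circle_imp_L2)
  \<comment> \<open>The factor \<open>cnj z\<close> moves index k + 1 to k, so projecting onto k
    \<ge> 0 keeps precisely the positive indices of F.\<close>
  have coeff_zF: "fourier_coeff (\<lambda>z. cnj z * F z $ i $ j) k = mat_coeff F (k + 1) $ i $ j" for i j k
  proof -
    have "fourier_coeff (\<lambda>z. cnj z * F z $ i $ j) k = fourier_coeff (\<lambda>z. z powi (-1) * F z $ i $ j) k"
      by (intro fourier_coeff_cong) (simp add: cnj_circle power_int_minus)
    then show ?thesis by (simp only: fourier_coeff_powi_mult) (simp add: mat_coeff_def)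
  qed
  have L2: "(\<lambda>z. G z $ i $ j) \<in> L2_circle" for i j
    unfolding G by (rule H2_D(1)[OF hardy_proj_spec(1)[OF zF]])
  have coeff: "fourier_coeff (\<lambda>z. G z $ i $ j) k = (if k \<ge> 0 then mat_coeff F (k + 1) $ i $ j else 0)" for i j k
    unfolding G by (simp add: fourier_coeff_hardy_proj[OF zF] coeff_zF)
  have "AE z in circle_measure. G z *v c = 0"
  proof (rule L2_vec_eqI)
    show "(\<lambda>z. G z *v c) \<in> L2_vec"
      unfolding L2_vec_def matrix_vector_mult_def
      using L2 by (auto simp: mult.commute[of _ "c $ _"] intro!: L2_circle_sum L2_circle_cmult)
    show "(\<lambda>z. 0) \<in> L2_vec" by (rule L2_vec_const)
    fix k
    have "fourier_coeff (\<lambda>z. \<Sum>j\<in>UNIV. c $ j * G z $ i $ j) k =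
        (if k \<ge> 0 then (mat_coeff F (k + 1) *v c) $ i else 0)" for i
    proof -
      have "fourier_coeff (\<lambda>z. \<Sum>j\<in>UNIV. c $ j * G z $ i $ j) k =
          (\<Sum>j\<in>UNIV. c $ j * fourier_coeff (\<lambda>z. G z $ i $ j) k)"
        using L2 by (simp add: fourier_coeff_sum L2_circle_integrable L2_circle_cmult fourier_coeff_cmult)
      then show ?thesis by (simp add: coeff matrix_vector_mult_def mult.commute)
    qed
    then show "vec_coeff (\<lambda>z. G z *v c) k = vec_coeff (\<lambda>z. 0) k"
      using c by (simp add: vec_coeff_def matrix_vector_mult_def vec_eq_iff mult.commute[of "c $ _"])
  qed
  then have "AE z in circle_measure. (\<Sum>j\<in>UNIV. c $ j *s column j (G z)) = 0"
    by (simp add: matrix_mult_sum)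
  with reg show ?thesis unfolding regular_mat_def G_def by blast
qed

text \<open>
  Compare the coefficient identity for \<open>z\<^sup>j v\<close> at \<open>i + 1\<close> with the one for \<open>z\<^sup>j\<^sup>+\<^sup>1 v\<close> at \<open>i\<close>:
  multiplying the argument by \<open>z\<close> shifts both operators up to a constant vector, and the two
  constants give the stated relation.
\<close>
lemma coefficient_relation:
  fixes \<phi> \<psi> :: "complex \<Rightarrow> complex^'n^'n"
  assumes \<phi>: "\<phi> \<in> Linf_mat" and \<psi>: "\<psi> \<in> Linf_mat"
    and comm: "\<And>h i. h \<in> H2_vec \<Longrightarrow> i \<ge> 0 \<Longrightarrow>
      vec_coeff (\<lambda>z. \<phi> z *v hankel (tilde \<psi>) h z) i =
      vec_coeff (\<lambda>z. \<psi> z *v toeplitz \<phi> h z) (- i - 1)"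
    and i: "i > 0" and j: "j > 0"
  shows "mat_coeff \<phi> i ** mat_coeff (tilde \<psi>) (- j) + mat_coeff \<psi> (- i) ** mat_coeff \<phi> (- j) = 0"
proof -
  note \<psi>' = Linf_mat_tilde[OF \<psi>]
  have "mat_coeff \<phi> i *v (mat_coeff (tilde \<psi>) (- j) *v v) +
      mat_coeff \<psi> (- i) *v (mat_coeff \<phi> (- j) *v v) = 0" for v
  proof -
    define e where "e j z = z powi j *s v" for j z
    define g where "g = hankel (tilde \<psi>) (e (j - 1))"
    define t where "t = toeplitz \<phi> (e (j - 1))"
    define a where "a = mat_coeff (tilde \<psi>) (- j) *v v"
    define b where "b = mat_coeff \<phi> (- j) *v v"
    have e: "e k \<in> H2_vec" if "k \<ge> 0" for k
      using H2_vec_powi[OF that] by (simp add: e_def[abs_def])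
    have eL: "e j \<in> L2_vec" "e (j - 1) \<in> L2_vec" using e j by (auto intro: H2_vec_L2)
    have coeff_e: "vec_coeff (\<lambda>z. F z *v e l z) k = mat_coeff F (k - l) *v v"
      if "F \<in> Linf_mat" for F :: "complex \<Rightarrow> complex^'n^'n" and l k
      unfolding e_def by (rule vec_coeff_mat_powi[OF that])
    have g: "g \<in> L2_vec" unfolding g_def by (intro H2_vec_L2 hankel_H2 \<psi>' eL)
    have t: "t \<in> L2_vec" unfolding t_def by (intro H2_vec_L2 toeplitz_H2 \<phi> eL)
    have ga: "(\<lambda>z. z powi (-1) *s (g z - a)) \<in> L2_vec"
      by (intro L2_vec_powi L2_vec_diff g L2_vec_const)
    have tb: "(\<lambda>z. z powi 1 *s t z + b) \<in> L2_vec"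
      by (intro L2_vec_powi L2_vec_add t L2_vec_const)
    \<comment> \<open>The flip turns multiplication by z into division by z. The vector a is the
      constant term of g; it is removed so that the quotient stays in \<open>H2_vec\<close>, and k =
      -1 is the index where this shows.\<close>
    have "AE z in circle_measure. hankel (tilde \<psi>) (e j) z = z powi (-1) *s (g z - a)"
    proof (rule L2_vec_eqI)
      have ix: "- (k - -1) - 1 - (j - 1) = - k - 1 - j" for k by simp
      show "vec_coeff (hankel (tilde \<psi>) (e j)) k = vec_coeff (\<lambda>z. z powi (-1) *s (g z - a)) k" for k
        unfolding vec_coeff_powi vec_coeff_diff[OF g L2_vec_const] vec_coeff_const
        unfolding g_def vec_coeff_hankel[OF \<psi>' eL(1)] vec_coeff_hankel[OF \<psi>' eL(2)] coeff_e[OF \<psi>'] ix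
        by (cases "k = -1") (auto simp: a_def)
    qed (intro H2_vec_L2 hankel_H2 \<psi>' eL ga)+
    from vec_coeff_mat_cong_AE[OF this _ ga \<phi>]
    have "vec_coeff (\<lambda>z. \<phi> z *v hankel (tilde \<psi>) (e j) z) (i - 1) =
        vec_coeff (\<lambda>z. \<phi> z *v (z powi (-1) *s (g z - a))) (i - 1)"
      by (simp add: H2_vec_L2 hankel_H2 \<psi>' eL)
    also have "\<dots> = vec_coeff (\<lambda>z. z powi (-1) *s (\<phi> z *v g z - \<phi> z *v a)) (i - 1)"
      by (simp only: vector_scalar_commute matrix_vector_mult_diff_distrib)
    also have "\<dots> = vec_coeff (\<lambda>z. \<phi> z *v g z) i - mat_coeff \<phi> i *v a"
      using L2_vec_mat[OF \<phi> g] L2_vec_mat[OF \<phi> L2_vec_const[of a]]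
      by (simp only: vec_coeff_powi vec_coeff_diff vec_coeff_mat_const[OF \<phi>]) simp
    finally have 1: "vec_coeff (\<lambda>z. \<phi> z *v hankel (tilde \<psi>) (e j) z) (i - 1) =
      vec_coeff (\<lambda>z. \<phi> z *v g z) i - mat_coeff \<phi> i *v a" .
    \<comment> \<open>The vector b is the coefficient at -1 of \<open>\<phi>\<close> times
      \<open>e (j - 1)\<close>: the projection discards it in t, but one more factor z brings it to
      index 0.\<close>
    have "AE z in circle_measure. toeplitz \<phi> (e j) z = z powi 1 *s t z + b"
    proof (rule L2_vec_eqI)
      show "vec_coeff (toeplitz \<phi> (e j)) k = vec_coeff (\<lambda>z. z powi 1 *s t z + b) k" for k
        unfolding vec_coeff_add[OF L2_vec_powi[OF t] L2_vec_const] vec_coeff_powi vec_coeff_const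
        unfolding t_def vec_coeff_toeplitz[OF \<phi> eL(1)] vec_coeff_toeplitz[OF \<phi> eL(2)] coeff_e[OF \<phi>]
        by (cases "k = 0") (auto simp: b_def)
    qed (intro H2_vec_L2 toeplitz_H2 \<phi> eL tb)+
    from vec_coeff_mat_cong_AE[OF this _ tb \<psi>]
    have "vec_coeff (\<lambda>z. \<psi> z *v toeplitz \<phi> (e j) z) (- i) =
        vec_coeff (\<lambda>z. \<psi> z *v (z powi 1 *s t z + b)) (- i)"
      by (simp add: H2_vec_L2 toeplitz_H2 \<phi> eL)
    also have "\<dots> = vec_coeff (\<lambda>z. z powi 1 *s (\<psi> z *v t z) + \<psi> z *v b) (- i)"
      by (simp only: vector_scalar_commute matrix_vector_right_distrib)
    also have "\<dots> = vec_coeff (\<lambda>z. \<psi> z *v t z) (- i - 1) + mat_coeff \<psi> (- i) *v b"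
      using L2_vec_powi[OF L2_vec_mat[OF \<psi> t], of 1] L2_vec_mat[OF \<psi> L2_vec_const[of b]]
      by (simp only: vec_coeff_powi vec_coeff_add vec_coeff_mat_const[OF \<psi>])
    finally have 2: "vec_coeff (\<lambda>z. \<psi> z *v toeplitz \<phi> (e j) z) (- i) =
      vec_coeff (\<lambda>z. \<psi> z *v t z) (- i - 1) + mat_coeff \<psi> (- i) *v b" .
    \<comment> \<open>Commutation is used twice, for \<open>e (j - 1)\<close> at i and for
      \<open>e j\<close> at i - 1; positivity of i and j makes both admissible. The terms in g and t
      cancel and leave a and b.\<close>
    have "vec_coeff (\<lambda>z. \<phi> z *v g z) i = vec_coeff (\<lambda>z. \<psi> z *v t z) (- i - 1)"
      unfolding g_def t_def using i j by (intro comm e) auto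
    moreover have "vec_coeff (\<lambda>z. \<phi> z *v hankel (tilde \<psi>) (e j) z) (i - 1) =
        vec_coeff (\<lambda>z. \<psi> z *v toeplitz \<phi> (e j) z) (- i)"
      using comm[OF e, of j "i - 1"] i j by simp
    ultimately have "mat_coeff \<phi> i *v a + mat_coeff \<psi> (- i) *v b = 0"
      unfolding 1 2 by (simp add: algebra_simps)
    then show ?thesis by (simp add: a_def b_def)
  qed
  then show ?thesis
    by (simp add: matrix_eq matrix_vector_mult_add_rdistrib matrix_vector_mul_assoc)
qed

text \<open>Each hypothesis acts on negative coefficients only: the first replaces
  \<open>\<psi>\<close> by \<open>\<phi> (cnj z) ** A\<close> in front of the analytic part p of u,
  the second rewrites \<open>hankel (tilde \<psi>) h\<close> through the remaining part m. Both
  contributions then carry the same left factor, and m + p is u again.\<close>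

lemma commutator_coeff:
  fixes \<phi> \<psi> :: "complex \<Rightarrow> complex^'n^'n"
  assumes \<phi>: "\<phi> \<in> Linf_mat" and \<psi>: "\<psi> \<in> Linf_mat" and h: "h \<in> H2_vec" and i: "i \<ge> 0"
    and an1: "analytic_mat (\<lambda>z. \<psi> z - \<phi> (cnj z) ** A)"
    and an2: "analytic_mat (\<lambda>z. tilde \<psi> z + A ** \<phi> z)"
  shows "vec_coeff (\<lambda>z. \<phi> z *v hankel (tilde \<psi>) h z) i -
         vec_coeff (\<lambda>z. \<psi> z *v toeplitz \<phi> h z) (- i - 1) =
         - vec_coeff (\<lambda>z. (\<phi> (cnj z) ** A ** \<phi> z) *v h z) (- i - 1)"
proof -
  note \<psi>' = Linf_mat_tilde[OF \<psi>] and hL = H2_vec_L2[OF h]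
  note \<phi>A = Linf_mat_mult[OF Linf_mat_comp_cnj[OF \<phi>] Linf_mat_const[of A]]
  define u where "u z = \<phi> z *v h z" for z
  define p where "p = toeplitz \<phi> h"
  define m where "m z = u z - p z" for z
  have u: "u \<in> L2_vec" unfolding u_def[abs_def] by (rule L2_vec_mat[OF \<phi> hL])
  have pH: "p \<in> H2_vec" unfolding p_def by (rule toeplitz_H2[OF \<phi> hL])
  note p = H2_vec_L2[OF pH]
  have m: "m \<in> L2_vec" unfolding m_def[abs_def] by (rule L2_vec_diff[OF u p])
  have coeff_m: "vec_coeff m k = (if k \<ge> 0 then 0 else vec_coeff u k)" for k
  proof -
    have "vec_coeff m k = vec_coeff u k - vec_coeff p k"
      unfolding m_def[abs_def] by (rule vec_coeff_diff[OF u p])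
    moreover have "vec_coeff p k = (if k \<ge> 0 then vec_coeff u k else 0)"
      unfolding p_def u_def[abs_def] by (rule vec_coeff_toeplitz[OF \<phi> hL])
    ultimately show ?thesis by simp
  qed
  \<comment> \<open>The two symbols differ by an analytic one, and p is in \<open>H2_vec\<close>, so
    the difference has no negative coefficients.\<close>
  have neg1: "vec_coeff (\<lambda>z. \<psi> z *v p z) k = vec_coeff (\<lambda>z. (\<phi> (cnj z) ** A) *v p z) k" if "k < 0" for k
    using vec_coeff_analytic_mult[OF Linf_mat_diff[OF \<psi> \<phi>A] an1 pH that]
      vec_coeff_diff[OF L2_vec_mat[OF \<psi> p] L2_vec_mat[OF \<phi>A p], of k]
    by (simp add: matrix_vector_mult_diff_rdistrib)
  \<comment> \<open>A is constant and passes through the coefficient, so the second hypothesis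
    expresses negative coefficients by those of u.\<close>
  have neg2: "vec_coeff (\<lambda>z. tilde \<psi> z *v h z) k = - (A *v vec_coeff u k)" if "k < 0" for k
  proof -
    have "vec_coeff (\<lambda>z. (tilde \<psi> z + A ** \<phi> z) *v h z) k = 0"
      by (rule vec_coeff_analytic_mult[OF Linf_mat_add[OF \<psi>' Linf_mat_mult[OF Linf_mat_const \<phi>]] an2 h that])
    moreover have "(tilde \<psi> z + A ** \<phi> z) *v h z = tilde \<psi> z *v h z + A *v u z" for z
      by (simp add: u_def matrix_vector_mult_add_rdistrib matrix_vector_mul_assoc)
    ultimately show ?thesis
      using vec_coeff_add[OF L2_vec_mat[OF \<psi>' hL] L2_vec_mat[OF Linf_mat_const u], of A k]
      by (simp add: vec_coeff_mat[OF u] eq_neg_iff_add_eq_0)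
  qed
  define J where "J z = cnj z *s m (cnj z)" for z
  have J: "J \<in> L2_vec" unfolding J_def[abs_def] by (rule L2_vec_flip[OF m])
  have coeff_J: "vec_coeff J k = vec_coeff m (- k - 1)" for k
    unfolding J_def[abs_def] by (rule vec_coeff_flip[OF m])
  note AJ = L2_vec_uminus[OF L2_vec_mat[OF Linf_mat_const J, of A]]
  have "AE z in circle_measure. hankel (tilde \<psi>) h z = - (A *v J z)"
  proof (rule L2_vec_eqI)
    show "vec_coeff (hankel (tilde \<psi>) h) k = vec_coeff (\<lambda>z. - (A *v J z)) k" for k
      using neg2[of "- k - 1"]
      by (simp add: vec_coeff_hankel[OF \<psi>' hL] vec_coeff_minus vec_coeff_mat[OF J] coeff_J coeff_m)
  qed (intro H2_vec_L2 hankel_H2 \<psi>' hL AJ)+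
  from vec_coeff_mat_cong_AE[OF this H2_vec_L2[OF hankel_H2[OF \<psi>' hL]] AJ \<phi>]
  have "vec_coeff (\<lambda>z. \<phi> z *v hankel (tilde \<psi>) h z) i = vec_coeff (\<lambda>z. \<phi> z *v (- (A *v J z))) i" .
  \<comment> \<open>Writing z as \<open>cnj (cnj z)\<close> under \<open>\<phi>\<close> exhibits the
    whole expression as a flip, so its coefficient at i is one at -i-1 with symbol
    \<open>\<phi> (cnj z) ** A\<close>.\<close>
  also have "\<dots> = vec_coeff (\<lambda>z. - (cnj z *s ((\<phi> (cnj (cnj z)) ** A) *v m (cnj z)))) i"
    by (simp add: J_def matrix_vector_mult_uminus vector_scalar_commute matrix_vector_mul_assoc)
  also have "\<dots> = - vec_coeff (\<lambda>z. (\<phi> (cnj z) ** A) *v m z) (- i - 1)"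
    unfolding vec_coeff_minus using vec_coeff_flip[OF L2_vec_mat[OF \<phi>A m]] by simp
  finally have "vec_coeff (\<lambda>z. \<phi> z *v hankel (tilde \<psi>) h z) i -
      vec_coeff (\<lambda>z. \<psi> z *v toeplitz \<phi> h z) (- i - 1) =
      - (vec_coeff (\<lambda>z. (\<phi> (cnj z) ** A) *v m z) (- i - 1) +
         vec_coeff (\<lambda>z. (\<phi> (cnj z) ** A) *v p z) (- i - 1))"
    using neg1[of "- i - 1"] i by (simp add: p_def)
  also have "\<dots> = - vec_coeff (\<lambda>z. (\<phi> (cnj z) ** A) *v m z + (\<phi> (cnj z) ** A) *v p z) (- i - 1)"
    using vec_coeff_add[OF L2_vec_mat[OF \<phi>A m] L2_vec_mat[OF \<phi>A p]] by simp
  also have "(\<lambda>z. (\<phi> (cnj z) ** A) *v m z + (\<phi> (cnj z) ** A) *v p z) =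
      (\<lambda>z. (\<phi> (cnj z) ** A ** \<phi> z) *v h z)"
    by (simp add: m_def u_def matrix_vector_right_distrib[symmetric] matrix_vector_mul_assoc)
  finally show ?thesis .
qed

theorem theorem2p5:
  fixes \<phi> \<psi> :: "complex \<Rightarrow> complex^'n^'n"
  assumes "\<phi> \<in> Linf_mat" and "\<psi> \<in> Linf_mat"
    and "regular_mat (hardy_proj_mat (\<lambda>z. \<chi> i j. cnj z * \<phi> z $ i $ j))"
    and "regular_mat (hardy_proj_mat (\<lambda>z. \<chi> i j. cnj z * cmat_adjoint (\<phi> z) $ i $ j))"
  shows "(\<forall>h\<in>H2_vec. AE z in circle_measure.
            toeplitz \<phi> (hardy_adjoint (hankel \<psi>) h) z = hankel \<psi> (toeplitz \<phi> h) z) \<longleftrightarrow>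
         (\<exists>A :: complex^'n^'n.
            analytic_mat (\<lambda>z. \<psi> z - \<phi> (cnj z) ** A) \<and>
            analytic_mat (\<lambda>z. tilde \<psi> z + A ** \<phi> z) \<and>
            analytic_mat (\<lambda>z. \<phi> (cnj z) ** A ** \<phi> z))"
    (is "?comm \<longleftrightarrow> (\<exists>A. ?an1 A \<and> ?an2 A \<and> ?an3 A)")
proof -
  note \<phi> = assms(1) and \<psi> = assms(2) and \<psi>' = Linf_mat_tilde[OF assms(2)]
  note \<phi>A\<phi> = Linf_mat_mult[OF Linf_mat_mult[OF Linf_mat_comp_cnj[OF \<phi>] Linf_mat_const] \<phi>]
  have comm_iff: "?comm \<longleftrightarrow> (\<forall>h\<in>H2_vec. \<forall>i\<ge>0.
      vec_coeff (\<lambda>z. \<phi> z *v hankel (tilde \<psi>) h z) i =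
      vec_coeff (\<lambda>z. \<psi> z *v toeplitz \<phi> h z) (- i - 1))"
    using commutation_iff[OF \<phi> \<psi>] by blast
  show ?thesis
  proof
    assume ?comm
    then have comm: "vec_coeff (\<lambda>z. \<phi> z *v hankel (tilde \<psi>) h z) i =
        vec_coeff (\<lambda>z. \<psi> z *v toeplitz \<phi> h z) (- i - 1)" if "h \<in> H2_vec" "i \<ge> 0" for h i
      using that unfolding comm_iff by blast
    have adj: "(\<lambda>z. cmat_adjoint (\<phi> z)) \<in> Linf_mat"
      using \<phi> by (simp add: Linf_mat_def cmat_adjoint_def Linf_circle_cnj)
    have pos: "k > 0 \<Longrightarrow> \<exists>i. k = int (Suc i)" for k :: int
      by (intro exI[of _ "nat k - 1"]) auto
    \<comment> \<open>Positive indices are written as \<open>int (Suc i)\<close>, giving families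
      over all of nat as the factorization lemma expects.\<close>
    have rel: "mat_coeff \<phi> (int (Suc i)) ** mat_coeff (tilde \<psi>) (- int (Suc j)) +
        mat_coeff \<psi> (- int (Suc i)) ** mat_coeff \<phi> (- int (Suc j)) = 0" for i j
      by (rule coefficient_relation[OF \<phi> \<psi> comm]) auto
    have ker1: "c = 0" if c: "\<And>i. mat_coeff \<phi> (int (Suc i)) *v c = 0" for c
    proof (rule regular_proj_kernel[OF \<phi> assms(3)])
      fix k :: int assume "k > 0"
      with pos obtain i where "k = int (Suc i)" by blast
      then show "mat_coeff \<phi> k *v c = 0" using c by simp
    qed
    \<comment> \<open>The coefficient of the pointwise adjoint at k is the adjoint of the
      coefficient of \<open>\<phi>\<close> at -k; the second regularity hypothesis therefore
      controls the ranges at negative indices.\<close>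
    have ker2: "c = 0" if c: "\<And>j. cmat_adjoint (mat_coeff \<phi> (- int (Suc j))) *v c = 0" for c
    proof (rule regular_proj_kernel[OF adj assms(4)])
      fix k :: int assume "k > 0"
      with pos obtain j where "k = int (Suc j)" by blast
      then show "mat_coeff (\<lambda>z. cmat_adjoint (\<phi> z)) k *v c = 0"
        using c[of j] by (simp only: mat_coeff_cmat_adjoint)
    qed
    \<comment> \<open>Here X and W are the coefficients of \<open>\<phi>\<close> at positive and
      negative indices, Z and Y those of \<open>\<psi>\<close> and \<open>tilde \<psi>\<close> at
      negative ones.\<close>
    have "\<exists>A. (\<forall>i. mat_coeff \<psi> (- int (Suc i)) = mat_coeff \<phi> (int (Suc i)) ** A) \<and>
        (\<forall>j. mat_coeff (tilde \<psi>) (- int (Suc j)) + A ** mat_coeff \<phi> (- int (Suc j)) = 0)"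
      by (rule common_factor_exists, rule rel, erule ker1, erule ker2)
    then obtain A
      where A1: "\<And>i. mat_coeff \<psi> (- int (Suc i)) = mat_coeff \<phi> (int (Suc i)) ** A"
        and A2: "\<And>j. mat_coeff (tilde \<psi>) (- int (Suc j)) + A ** mat_coeff \<phi> (- int (Suc j)) = 0"
      by blast
    have neg: "k < 0 \<Longrightarrow> \<exists>i. k = - int (Suc i)" for k :: int
      by (intro exI[of _ "nat (- k) - 1"]) auto
    have an1: "?an1 A"
      unfolding analytic_mat_iff
    proof (intro allI impI mat_coeff_eqI)
      fix k :: int and c assume "k < 0"
      with neg obtain i where k: "k = - int (Suc i)" by blast
      have "vec_coeff (\<lambda>z. (\<psi> z - \<phi> (cnj z) ** A) *v c) k =
          vec_coeff (\<lambda>z. \<psi> z *v c - \<phi> (cnj z) *v (A *v c)) k"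
        by (simp add: matrix_vector_mult_diff_rdistrib matrix_vector_mul_assoc)
      also have "\<dots> = mat_coeff \<psi> k *v c - mat_coeff \<phi> (- k) *v (A *v c)"
        using vec_coeff_diff[OF L2_vec_mat[OF \<psi> L2_vec_const] L2_vec_comp_cnj[OF L2_vec_mat[OF \<phi> L2_vec_const]]]
          vec_coeff_comp_cnj[OF L2_vec_mat[OF \<phi> L2_vec_const]]
        by (simp add: vec_coeff_mat_const \<phi> \<psi>)
      also have "\<dots> = 0"
        unfolding k A1 minus_minus matrix_vector_mul_assoc by simp
      finally show "vec_coeff (\<lambda>z. (\<psi> z - \<phi> (cnj z) ** A) *v c) k = 0 *v c" by simp
    qed (rule Linf_mat_diff[OF \<psi> Linf_mat_mult[OF Linf_mat_comp_cnj[OF \<phi>] Linf_mat_const]])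
    have an2: "?an2 A"
      unfolding analytic_mat_iff
    proof (intro allI impI mat_coeff_eqI)
      fix k :: int and c assume "k < 0"
      with neg obtain i where k: "k = - int (Suc i)" by blast
      have "vec_coeff (\<lambda>z. (tilde \<psi> z + A ** \<phi> z) *v c) k =
          vec_coeff (\<lambda>z. tilde \<psi> z *v c + A *v (\<phi> z *v c)) k"
        by (simp add: matrix_vector_mult_add_rdistrib matrix_vector_mul_assoc)
      also have "\<dots> = vec_coeff (\<lambda>z. tilde \<psi> z *v c) k + vec_coeff (\<lambda>z. A *v (\<phi> z *v c)) k"
        by (rule vec_coeff_add[OF L2_vec_mat[OF \<psi>' L2_vec_const]
              L2_vec_mat[OF Linf_mat_const L2_vec_mat[OF \<phi> L2_vec_const]]])
      also have "\<dots> = (mat_coeff (tilde \<psi>) k + A ** mat_coeff \<phi> k) *v c"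
        unfolding vec_coeff_mat[OF L2_vec_mat[OF \<phi> L2_vec_const]]
          vec_coeff_mat_const[OF \<phi>] vec_coeff_mat_const[OF \<psi>']
        by (simp add: matrix_vector_mult_add_rdistrib matrix_vector_mul_assoc)
      also have "\<dots> = 0"
        unfolding k A2 by simp
      finally show "vec_coeff (\<lambda>z. (tilde \<psi> z + A ** \<phi> z) *v c) k = 0 *v c" by simp
    qed (rule Linf_mat_add[OF \<psi>' Linf_mat_mult[OF Linf_mat_const \<phi>]])
    have "?an3 A"
      unfolding analytic_mat_iff
    proof (intro allI impI mat_coeff_eqI \<phi>A\<phi>)
      fix k :: int and c :: "complex^'n" assume "k < 0"
      \<comment> \<open>Constant arguments suffice: on them the commutator formula returns the
        negative coefficients of the triple product applied to c.\<close>
      have c: "(\<lambda>z. c) \<in> H2_vec"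
        by (simp add: H2_vec_iff L2_vec_const vec_coeff_const)
      show "vec_coeff (\<lambda>z. (\<phi> (cnj z) ** A ** \<phi> z) *v c) k = 0 *v c"
        using commutator_coeff[OF \<phi> \<psi> c _ an1 an2, of "- k - 1"] comm[OF c, of "- k - 1"] \<open>k < 0\<close>
        by simp
    qed
    with an1 an2 show "\<exists>A. ?an1 A \<and> ?an2 A \<and> ?an3 A" by blast
  next
    assume "\<exists>A. ?an1 A \<and> ?an2 A \<and> ?an3 A"
    then obtain A where A: "?an1 A" "?an2 A" "?an3 A" by blast
    show ?comm
      unfolding comm_iff
    proof (intro ballI allI impI)
      fix h :: "complex \<Rightarrow> complex^'n" and i :: int
      assume h: "h \<in> H2_vec" and i: "i \<ge> 0"
      \<comment> \<open>An analytic symbol maps \<open>H2_vec\<close> to functions without negative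
        frequencies, so the commutator vanishes on every h.\<close>
      have "vec_coeff (\<lambda>z. (\<phi> (cnj z) ** A ** \<phi> z) *v h z) (- i - 1) = 0"
        using i by (intro vec_coeff_analytic_mult[OF \<phi>A\<phi> A(3) h]) simp
      with commutator_coeff[OF \<phi> \<psi> h i A(1,2)]
      show "vec_coeff (\<lambda>z. \<phi> z *v hankel (tilde \<psi>) h z) i =
          vec_coeff (\<lambda>z. \<psi> z *v toeplitz \<phi> h z) (- i - 1)"
        by simp
    qed
  qed
qed

end
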